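(* For $\lambda\in kG$, the Jacobson radical of $H_\lambda$ is zero: $\operatorname{Rad}H_\lambda=0$.
   Context: Let $p$ be an odd prime, $k$ an algebraically closed field of characteristic $p$, and $G=\langle g\rangle$ the cyclic group of order $p$ generated by $g=\begin{pmatrix}1&1\\0&1\end{pmatrix}\in \mathrm{SL}(2,p)$. $G$ acts on the free algebra $k\langle x,y\rangle$ by algebra automorphisms with $g\cdot x=x$, $g\cdot y=x+y$, and $k\langle x,y\rangle\rtimes G$ is the smash product (so $gf=(g\cdot f)g$). For $\lambda\in kG$ set $H_\lambda=(k\langle x,y\rangle\rtimes G)/(xy-yx-\lambda)$. *)

theory Defs
  imports
    "HOL-Algebra.QuotRing"
    "HOL-Algebra.Multiplicative_Group"
    "HOL-Algebra.Generated_Groups"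
    "HOL-Analysis.Determinants"
    "HOL-Computational_Algebra.Polynomial"
    "HOL-Computational_Algebra.Primes"
    "HOL-Library.Poly_Mapping"
begin

section \<open>Jacobson radical of a (noncommutative) ring\<close>

definition left_ideal :: "'a set \<Rightarrow> ('a, 'm) ring_scheme \<Rightarrow> bool" where
  "left_ideal I R \<longleftrightarrow>
     additive_subgroup I R \<and> (\<forall>r\<in>carrier R. \<forall>a\<in>I. r \<otimes>\<^bsub>R\<^esub> a \<in> I)"

definition maximal_left_ideal :: "'a set \<Rightarrow> ('a, 'm) ring_scheme \<Rightarrow> bool" where
  "maximal_left_ideal I R \<longleftrightarrow>
     left_ideal I R \<and> I \<noteq> carrier R \<and>
     (\<forall>J. left_ideal J R \<and> I \<subseteq> J \<longrightarrow> J = I \<or> J = carrier R)"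

definition jacobson_radical :: "('a, 'm) ring_scheme \<Rightarrow> 'a set" where
  "jacobson_radical R = carrier R \<inter> \<Inter>{I. maximal_left_ideal I R}"


section \<open>Free algebras\<close>

text \<open>
  The free algebra is the monoid algebra of the free monoid. Since
  \<^type>\<open>poly_mapping\<close> takes its product from an additive monoid of exponents,
  concatenation of words is written additively.
\<close>

datatype 'i word = Word (letters: "'i list")

instantiation word :: (type) monoid_add
begin

definition "0 = Word []"
definition "u + v = Word (letters u @ letters v)"

instance
  by standard (simp_all add: zero_word_def plus_word_def)

end

lemma letters_zero [simp]: "letters 0 = []"
  by (simp add: zero_word_def)

lemma letters_plus [simp]: "letters (u + v) = letters u @ letters v"
  by (simp add: plus_word_def)

type_synonym ('i, 'k) free_algebra = "'i word \<Rightarrow>\<^sub>0 'k"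

definition scalar :: "'k \<Rightarrow> ('i, 'k::comm_ring_1) free_algebra" where
  "scalar c = Poly_Mapping.single 0 c"

definition gen :: "'i \<Rightarrow> ('i, 'k::comm_ring_1) free_algebra" where
  "gen i = Poly_Mapping.single (Word [i]) 1"

text \<open>The algebra endomorphism sending each generator \<open>gen i\<close> to \<open>\<phi> i\<close>.\<close>

definition subst_gens ::
    "('i \<Rightarrow> ('i, 'k) free_algebra) \<Rightarrow> ('i, 'k::comm_ring_1) free_algebra \<Rightarrow> ('i, 'k) free_algebra" where
  "subst_gens \<phi> f =
     (\<Sum>w\<in>Poly_Mapping.keys f.
        scalar (Poly_Mapping.lookup f w) * prod_list (map \<phi> (letters w)))"

text \<open>
  A matrix acts on the span of the generators, regarded as basis vectors, in the usual
  way: the image of the \<open>j\<close>-th generator is given by the \<open>j\<close>-th column.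
\<close>

definition linear_act ::
    "'k^'i^'i \<Rightarrow> ('i::finite, 'k::comm_ring_1) free_algebra \<Rightarrow> ('i, 'k) free_algebra" where
  "linear_act A = subst_gens (\<lambda>j. \<Sum>i\<in>UNIV. scalar (A $ i $ j) * gen i)"


section \<open>Smash products with finite groups\<close>

text \<open>
  For a finite group \<open>G\<close>, the function \<open>u\<close> encodes \<open>\<Sum>h\<in>G. u h \<cdot> h\<close>. The product is
  determined by \<open>(a \<cdot> h) (b \<cdot> h') = (a * act h b) \<cdot> (h h')\<close>.
\<close>

definition smash_product ::
    "('g, 'm) monoid_scheme \<Rightarrow> ('g \<Rightarrow> 'a \<Rightarrow> 'a::ring_1) \<Rightarrow> ('g \<Rightarrow> 'a) ring" where
  "smash_product G act =
     \<lparr>carrier = {u. \<forall>h. h \<notin> carrier G \<longrightarrow> u h = 0},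
      monoid.mult = (\<lambda>u v h. if h \<in> carrier G
         then \<Sum>a\<in>carrier G. u a * act a (v (inv\<^bsub>G\<^esub> a \<otimes>\<^bsub>G\<^esub> h)) else 0),
      one = (\<lambda>h. if h = \<one>\<^bsub>G\<^esub> then 1 else 0),
      zero = (\<lambda>h. 0),
      add = (\<lambda>u v h. u h + v h)\<rparr>"

definition smash_of_alg :: "('g, 'm) monoid_scheme \<Rightarrow> 'a::ring_1 \<Rightarrow> 'g \<Rightarrow> 'a" where
  "smash_of_alg G a = (\<lambda>h. if h = \<one>\<^bsub>G\<^esub> then a else 0)"

definition smash_of_group :: "'g \<Rightarrow> 'g \<Rightarrow> 'a::ring_1" where
  "smash_of_group h = (\<lambda>h'. if h' = h then 1 else 0)"

text \<open>Underlying set of the group algebra \<open>kG\<close> of a finite group.\<close>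

definition group_algebra_elems :: "('g, 'm) monoid_scheme \<Rightarrow> ('g \<Rightarrow> 'k::zero) set" where
  "group_algebra_elems G = {c. \<forall>h. h \<notin> carrier G \<longrightarrow> c h = 0}"

definition smash_of_group_algebra ::
    "('g \<Rightarrow> 'k::comm_ring_1) \<Rightarrow> 'g \<Rightarrow> ('i, 'k) free_algebra" where
  "smash_of_group_algebra c = (\<lambda>h. scalar (c h))"


section \<open>The algebras \<open>H\<^sub>\<lambda>\<close>\<close>

text \<open>
  In characteristic \<open>p\<close> the set \<open>\<int>\<close> of images of integers is the prime field of \<open>k\<close>, so
  this is \<open>SL(2,p)\<close> inside the matrices over \<open>k\<close>.
\<close>

definition SL2_prime_field :: "('k::field^2^2) monoid" where
  "SL2_prime_field =
     \<lparr>carrier = {A. det A = 1 \<and> (\<forall>i j. A $ i $ j \<in> \<int>)}, monoid.mult = (**), one = mat 1\<rparr>"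

definition transvection :: "'k::field^2^2" where
  "transvection = vector [vector [1, 1], vector [0, 1]]"

definition transvection_group :: "('k::field^2^2) monoid" where
  "transvection_group = subgroup_generated SL2_prime_field {transvection}"

text \<open>The free algebra \<open>k\<langle>x,y\<rangle>\<close> has its two generators indexed by the type \<^typ>\<open>2\<close>.\<close>

abbreviation gen_x :: "(2, 'k::field) free_algebra" where "gen_x \<equiv> gen 1"
abbreviation gen_y :: "(2, 'k::field) free_algebra" where "gen_y \<equiv> gen 2"

definition smash_algebra :: "('k::field^2^2 \<Rightarrow> (2, 'k) free_algebra) ring" where
  "smash_algebra = smash_product transvection_group linear_act"

definition H_relator :: "('k::field^2^2 \<Rightarrow> 'k) \<Rightarrow> 'k^2^2 \<Rightarrow> (2, 'k) free_algebra" where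
  "H_relator lam =
     smash_of_alg transvection_group (gen_x * gen_y - gen_y * gen_x)
       \<ominus>\<^bsub>smash_algebra\<^esub> smash_of_group_algebra lam"

definition H_algebra ::
    "('k::field^2^2 \<Rightarrow> 'k) \<Rightarrow> ('k^2^2 \<Rightarrow> (2, 'k) free_algebra) set ring" where
  "H_algebra lam = smash_algebra Quot (Idl\<^bsub>smash_algebra\<^esub> {H_relator lam})"


section \<open>Basic facts\<close>

subsection \<open>Smash products are rings\<close>

lemma smash_product_ring:
  fixes act :: "'g \<Rightarrow> 'a \<Rightarrow> 'a::ring_1"
  assumes G: "group G" and fin: "finite (carrier G)"
    and add: "\<And>h a b. h \<in> carrier G \<Longrightarrow> act h (a + b) = act h a + act h b"
    and mult: "\<And>h a b. h \<in> carrier G \<Longrightarrow> act h (a * b) = act h a * act h b"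
    and one: "\<And>h. h \<in> carrier G \<Longrightarrow> act h 1 = 1"
    and act1: "\<And>a. act \<one>\<^bsub>G\<^esub> a = a"
    and comp: "\<And>h h' a. \<lbrakk>h \<in> carrier G; h' \<in> carrier G\<rbrakk>
                 \<Longrightarrow> act (h \<otimes>\<^bsub>G\<^esub> h') a = act h (act h' a)"
  shows "ring (smash_product G act)"
proof -
  interpret G: group G by fact
  let ?S = "smash_product G act"
  have act0: "act h 0 = 0" if "h \<in> carrier G" for h
    using add[OF that, of 0 0] by simp
  have act_sum: "act h (sum f A) = (\<Sum>a\<in>A. act h (f a))"
    if "h \<in> carrier G" for h f and A :: "'g set"
    by (induction A rule: infinite_finite_induct) (simp_all add: act0 add that)
  show ?thesis
  proof (rule ringI)
    show "abelian_group ?S"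
    proof (rule abelian_groupI)
      fix u assume "u \<in> carrier ?S"
      then show "\<exists>v\<in>carrier ?S. v \<oplus>\<^bsub>?S\<^esub> u = \<zero>\<^bsub>?S\<^esub>"
        by (intro bexI[of _ "\<lambda>h. - u h"]) (auto simp: smash_product_def)
    qed (auto simp: smash_product_def add_ac)
  next
    show "Group.monoid ?S"
    proof (rule monoidI)
      fix u v w assume u: "u \<in> carrier ?S" and v: "v \<in> carrier ?S" and w: "w \<in> carrier ?S"
      have "(\<Sum>b\<in>carrier G. (\<Sum>a\<in>carrier G. u a * act a (v (inv\<^bsub>G\<^esub> a \<otimes>\<^bsub>G\<^esub> b)))
                * act b (w (inv\<^bsub>G\<^esub> b \<otimes>\<^bsub>G\<^esub> h)))
          = (\<Sum>a\<in>carrier G. u a * act a (\<Sum>c\<in>carrier G. v c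
                * act c (w (inv\<^bsub>G\<^esub> c \<otimes>\<^bsub>G\<^esub> (inv\<^bsub>G\<^esub> a \<otimes>\<^bsub>G\<^esub> h)))))" (is "?L = ?R")
        if h: "h \<in> carrier G" for h
      proof -
        have "?L = (\<Sum>a\<in>carrier G. \<Sum>b\<in>carrier G. u a * act a (v (inv\<^bsub>G\<^esub> a \<otimes>\<^bsub>G\<^esub> b))
                * act b (w (inv\<^bsub>G\<^esub> b \<otimes>\<^bsub>G\<^esub> h)))"
          unfolding sum_distrib_right by (rule sum.swap)
        also have "\<dots> = ?R"
        proof (rule sum.cong[OF refl])
          fix a assume a: "a \<in> carrier G"
          have "(\<Sum>b\<in>carrier G. u a * act a (v (inv\<^bsub>G\<^esub> a \<otimes>\<^bsub>G\<^esub> b)) * act b (w (inv\<^bsub>G\<^esub> b \<otimes>\<^bsub>G\<^esub> h)))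
             = (\<Sum>c\<in>carrier G. u a * act a (v c) *
                  act (a \<otimes>\<^bsub>G\<^esub> c) (w (inv\<^bsub>G\<^esub> (a \<otimes>\<^bsub>G\<^esub> c) \<otimes>\<^bsub>G\<^esub> h)))"
            by (rule sum.reindex_bij_witness[of _ "\<lambda>c. a \<otimes>\<^bsub>G\<^esub> c" "\<lambda>b. inv\<^bsub>G\<^esub> a \<otimes>\<^bsub>G\<^esub> b"])
               (use a in \<open>auto simp: G.m_assoc[symmetric]\<close>)
          also have "\<dots> = u a * act a (\<Sum>c\<in>carrier G. v c
                * act c (w (inv\<^bsub>G\<^esub> c \<otimes>\<^bsub>G\<^esub> (inv\<^bsub>G\<^esub> a \<otimes>\<^bsub>G\<^esub> h))))"
            unfolding act_sum[OF a] sum_distrib_left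
            by (rule sum.cong) (use a h in \<open>auto simp: mult comp G.inv_mult_group G.m_assoc mult.assoc\<close>)
          finally show "(\<Sum>b\<in>carrier G. u a * act a (v (inv\<^bsub>G\<^esub> a \<otimes>\<^bsub>G\<^esub> b)) * act b (w (inv\<^bsub>G\<^esub> b \<otimes>\<^bsub>G\<^esub> h)))
             = u a * act a (\<Sum>c\<in>carrier G. v c
                * act c (w (inv\<^bsub>G\<^esub> c \<otimes>\<^bsub>G\<^esub> (inv\<^bsub>G\<^esub> a \<otimes>\<^bsub>G\<^esub> h))))" .
        qed
        finally show ?thesis .
      qed
      then show "u \<otimes>\<^bsub>?S\<^esub> v \<otimes>\<^bsub>?S\<^esub> w = u \<otimes>\<^bsub>?S\<^esub> (v \<otimes>\<^bsub>?S\<^esub> w)"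
        by (auto simp: smash_product_def fun_eq_iff cong: sum.cong)
    next
      fix u assume u: "u \<in> carrier ?S"
      have "(\<Sum>a\<in>carrier G. (if a = \<one>\<^bsub>G\<^esub> then 1 else 0) * act a (u (inv\<^bsub>G\<^esub> a \<otimes>\<^bsub>G\<^esub> h)))
          = (\<Sum>a\<in>carrier G. if a = \<one>\<^bsub>G\<^esub> then act a (u (inv\<^bsub>G\<^esub> a \<otimes>\<^bsub>G\<^esub> h)) else 0)" for h
        by (rule sum.cong) auto
      then show "\<one>\<^bsub>?S\<^esub> \<otimes>\<^bsub>?S\<^esub> u = u"
        using u by (auto simp: smash_product_def fun_eq_iff fin act1)
      have "(\<Sum>a\<in>carrier G. u a * act a (if inv\<^bsub>G\<^esub> a \<otimes>\<^bsub>G\<^esub> h = \<one>\<^bsub>G\<^esub> then 1 else 0))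
          = (\<Sum>a\<in>carrier G. if a = h then u a else 0)" if h: "h \<in> carrier G" for h
      proof (rule sum.cong)
        fix a assume a: "a \<in> carrier G"
        have "inv\<^bsub>G\<^esub> a \<otimes>\<^bsub>G\<^esub> h = \<one>\<^bsub>G\<^esub> \<longleftrightarrow> a = h"
          using a h by (metis G.inv_closed G.inv_equality G.inv_inv G.l_inv)
        then show "u a * act a (if inv\<^bsub>G\<^esub> a \<otimes>\<^bsub>G\<^esub> h = \<one>\<^bsub>G\<^esub> then 1 else 0) = (if a = h then u a else 0)"
          using a h by (auto simp: one act0)
      qed simp
      then show "u \<otimes>\<^bsub>?S\<^esub> \<one>\<^bsub>?S\<^esub> = u"
        using u by (auto simp: smash_product_def fun_eq_iff fin)
    qed (auto simp: smash_product_def)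
  qed (auto simp: smash_product_def fun_eq_iff add distrib_left distrib_right sum.distrib)
qed


subsection \<open>The action on the free algebra\<close>

lemma scalar_add: "scalar (a + b) = scalar a + scalar b"
  by (simp add: scalar_def single_add)

lemma scalar_mult: "scalar (a * b) = scalar a * scalar b"
  by (simp add: scalar_def mult_single)

lemma scalar_0 [simp]: "scalar 0 = 0" and scalar_1 [simp]: "scalar 1 = 1"
  by (simp_all add: scalar_def)

lemma scalar_sum: "scalar (sum f A) = (\<Sum>a\<in>A. scalar (f a))"
  by (induction A rule: infinite_finite_induct) (simp_all add: scalar_add)

lemma free_algebra_induct [case_names add single]:
  assumes "\<And>f g. P f \<Longrightarrow> P g \<Longrightarrow> P (f + g)" and "\<And>w c. P (Poly_Mapping.single w c)"
  shows "P (f :: ('i, 'k::comm_ring_1) free_algebra)"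
proof -
  have "P (\<Sum>w\<in>A. Poly_Mapping.single w (Poly_Mapping.lookup f w))" if "finite A" for A
    using that by (induction A) (use assms(1) assms(2) assms(2)[of _ 0] in \<open>auto\<close>)
  moreover have "f = (\<Sum>w\<in>Poly_Mapping.keys f. Poly_Mapping.single w (Poly_Mapping.lookup f w))"
    by (rule poly_mapping_eqI) (auto simp: lookup_sum lookup_single when_def in_keys_iff)
  ultimately show ?thesis
    by (metis finite_keys)
qed

lemma scalar_commute: "scalar c * f = f * scalar c"
  by (induction f rule: free_algebra_induct)
     (simp_all add: distrib_left distrib_right scalar_def mult_single mult.commute)

lemma subst_gens_single:
  "subst_gens \<phi> (Poly_Mapping.single w c) = scalar c * prod_list (map \<phi> (letters w))"
  by (simp add: subst_gens_def)

lemma subst_gens_scalar [simp]: "subst_gens \<phi> (scalar c) = scalar c"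
  by (subst scalar_def) (simp add: subst_gens_single)

lemma subst_gens_1 [simp]: "subst_gens \<phi> 1 = 1"
  using subst_gens_scalar[of \<phi> 1] by simp

lemma subst_gens_gen [simp]: "subst_gens \<phi> (gen i) = \<phi> i"
  by (simp add: gen_def subst_gens_single)

lemma subst_gens_add: "subst_gens \<phi> (f + g) = subst_gens \<phi> f + subst_gens \<phi> g"
  unfolding subst_gens_def
  by (rule setsum_keys_plus_distrib) (simp_all add: scalar_add distrib_right)

lemma subst_gens_mult: "subst_gens \<phi> (f * g) = subst_gens \<phi> f * subst_gens \<phi> g"
proof (induction f rule: free_algebra_induct)
  case (add f f')
  then show ?case by (simp add: distrib_right subst_gens_add)
next
  case (single v c)
  show ?case
  proof (induction g rule: free_algebra_induct)
    case (add g g')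
    then show ?case by (simp add: distrib_left subst_gens_add)
  next
    case (single w d)
    show ?case
      by (simp add: mult_single subst_gens_single scalar_mult)
         (metis (no_types, lifting) mult.assoc scalar_commute)
  qed
qed

lemma subst_gens_sum: "subst_gens \<phi> (sum f A) = (\<Sum>a\<in>A. subst_gens \<phi> (f a))"
proof (induction A rule: infinite_finite_induct)
  case (insert a A)
  then show ?case by (simp add: subst_gens_add)
qed (simp_all add: subst_gens_def)

lemma prod_list_gens: "prod_list (map gen (letters w)) = Poly_Mapping.single w 1"
proof -
  have "prod_list (map gen xs) = (Poly_Mapping.single (Word xs) 1 :: ('a, 'b) free_algebra)" for xs
    by (induction xs) (simp_all add: gen_def mult_single plus_word_def flip: zero_word_def)
  from this[of "letters w"] show ?thesis by simp
qed

lemma subst_gens_id: "subst_gens gen f = f"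
  by (induction f rule: free_algebra_induct)
     (simp_all add: subst_gens_add subst_gens_single prod_list_gens scalar_def mult_single)

lemma subst_gens_comp: "subst_gens \<phi> (subst_gens \<psi> f) = subst_gens (\<lambda>i. subst_gens \<phi> (\<psi> i)) f"
proof (induction f rule: free_algebra_induct)
  case (single w c)
  have "subst_gens \<phi> (prod_list (map \<psi> xs)) = prod_list (map (\<lambda>i. subst_gens \<phi> (\<psi> i)) xs)" for xs
    by (induction xs) (simp_all add: subst_gens_mult)
  then show ?case by (simp add: subst_gens_single subst_gens_mult)
qed (simp add: subst_gens_add)

lemma linear_act_1: "linear_act (mat 1) (f :: ('i::finite, 'k::comm_ring_1) free_algebra) = f"
proof -
  have "scalar (mat 1 $ i $ j) * gen i = (if i = j then gen i else 0 :: ('i, 'k) free_algebra)"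
    for i j :: 'i
    by (simp add: mat_def)
  then have "(\<Sum>i\<in>UNIV. scalar (mat 1 $ i $ j) * gen i) = (gen j :: ('i, 'k) free_algebra)" for j
    by simp
  then show ?thesis by (simp add: linear_act_def subst_gens_id)
qed

lemma linear_act_comp:
  fixes f :: "('i::finite, 'k::comm_ring_1) free_algebra"
  shows "linear_act (A ** B) f = linear_act A (linear_act B f)"
proof -
  have "(\<Sum>i\<in>UNIV. scalar ((A ** B) $ i $ j) * gen i)
      = (\<Sum>l\<in>UNIV. scalar (B $ l $ j) *
           (\<Sum>i\<in>UNIV. scalar (A $ i $ l) * (gen i :: ('i, 'k) free_algebra)))" for j
  proof -
    have "(\<Sum>i\<in>UNIV. scalar ((A ** B) $ i $ j) * (gen i :: ('i, 'k) free_algebra))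
        = (\<Sum>i\<in>UNIV. \<Sum>l\<in>UNIV. scalar (B $ l $ j) * (scalar (A $ i $ l) * gen i))"
      by (simp add: matrix_matrix_mult_def scalar_sum sum_distrib_right mult.commute[of "A $ _ $ _"]
            scalar_mult mult.assoc)
    also have "\<dots> = (\<Sum>l\<in>UNIV. \<Sum>i\<in>UNIV. scalar (B $ l $ j) * (scalar (A $ i $ l) * gen i))"
      by (rule sum.swap)
    finally show ?thesis by (simp add: sum_distrib_left)
  qed
  then show ?thesis
    by (simp add: linear_act_def subst_gens_comp subst_gens_sum subst_gens_mult)
qed

lemma linear_act_transvection:
  "linear_act transvection gen_x = gen_x"
  "linear_act transvection gen_y = gen_x + gen_y"
  by (simp_all add: linear_act_def transvection_def sum_2)


subsection \<open>The group\<close>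

lemma SL2_prime_field_group: "group (SL2_prime_field :: ('k::field^2^2) monoid)"
proof (rule groupI)
  fix A :: "'k^2^2" assume A: "A \<in> carrier SL2_prime_field"
  let ?B = "vector [vector [A$2$2, - (A$1$2)], vector [- (A$2$1), A$1$1]] :: 'k^2^2"
  have "?B \<in> carrier SL2_prime_field" "?B ** A = mat 1"
    using A by (auto simp: SL2_prime_field_def det_2 forall_2 vec_eq_iff mat_def
        matrix_matrix_mult_def sum_2 algebra_simps)
  then show "\<exists>B\<in>carrier SL2_prime_field. B \<otimes>\<^bsub>SL2_prime_field\<^esub> A = \<one>\<^bsub>SL2_prime_field\<^esub>"
    by (intro bexI[of _ ?B]) (auto simp: SL2_prime_field_def)
next
  fix A B :: "'k^2^2" assume "A \<in> carrier SL2_prime_field" "B \<in> carrier SL2_prime_field"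
  then show "A \<otimes>\<^bsub>SL2_prime_field\<^esub> B \<in> carrier SL2_prime_field"
    by (auto simp: SL2_prime_field_def det_mul) (simp add: matrix_matrix_mult_def sum_2)
qed (simp_all add: SL2_prime_field_def matrix_mul_assoc, simp add: mat_def)

lemma transvection_in_SL2: "transvection \<in> carrier SL2_prime_field"
  by (simp add: SL2_prime_field_def transvection_def det_2 forall_2)

lemma carrier_transvection_group:
  "carrier transvection_group = generate SL2_prime_field {transvection}"
  by (simp add: transvection_group_def carrier_subgroup_generated Int_absorb1 transvection_in_SL2)

lemma transvection_group_group: "group transvection_group"
  unfolding transvection_group_def
  by (rule group.group_subgroup_generated[OF SL2_prime_field_group])

lemma transvection_pow:
  "transvection [^]\<^bsub>SL2_prime_field\<^esub> (n::nat)
     = (vector [vector [1, of_nat n], vector [0, 1]] :: 'k::field^2^2)"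
proof -
  interpret SL: group "SL2_prime_field :: ('k^2^2) monoid" by (rule SL2_prime_field_group)
  show ?thesis
  proof (induction n)
    case 0
    then show ?case by (simp add: SL2_prime_field_def vec_eq_iff forall_2 mat_def)
  next
    case (Suc n)
    then show ?case
      by (simp add: SL.nat_pow_Suc)
         (simp add: SL2_prime_field_def transvection_def vec_eq_iff forall_2
            matrix_matrix_mult_def sum_2 add.commute)
  qed
qed

lemma transvection_ord: "group.ord SL2_prime_field (transvection :: 'k::field^2^2) = CHAR('k)"
proof -
  interpret SL: group "SL2_prime_field :: ('k^2^2) monoid" by (rule SL2_prime_field_group)
  have "(vector [vector [1, of_nat n], vector [0, 1]] = (mat 1 :: 'k^2^2))
      \<longleftrightarrow> CHAR('k) dvd n" for n :: nat
    by (simp add: vec_eq_iff forall_2 mat_def of_nat_eq_0_iff_char_dvd)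
  then have "(transvection :: 'k^2^2) [^]\<^bsub>SL2_prime_field\<^esub> n = \<one>\<^bsub>SL2_prime_field\<^esub>
      \<longleftrightarrow> CHAR('k) dvd n" for n :: nat
    by (simp add: transvection_pow) (simp add: SL2_prime_field_def)
  then show ?thesis
    using SL.ord_unique[OF transvection_in_SL2] by blast
qed

lemma card_transvection_group: "card (carrier (transvection_group :: ('k::field^2^2) monoid)) = CHAR('k)"
proof -
  interpret SL: group "SL2_prime_field :: ('k^2^2) monoid" by (rule SL2_prime_field_group)
  show ?thesis
    using SL.generate_pow_card[OF transvection_in_SL2]
    by (simp add: carrier_transvection_group transvection_ord)
qed

lemma smash_algebra_ring:
  assumes "CHAR('k::field) > 0"
  shows "ring (smash_algebra :: ('k^2^2 \<Rightarrow> (2, 'k) free_algebra) ring)"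
proof -
  have "finite (carrier (transvection_group :: ('k^2^2) monoid))"
    using assms by (intro card_ge_0_finite) (simp add: card_transvection_group)
  moreover have "\<one>\<^bsub>transvection_group\<^esub> = (mat 1 :: 'k^2^2)"
    "A \<otimes>\<^bsub>transvection_group\<^esub> B = A ** B" for A B :: "'k^2^2"
    by (simp_all add: transvection_group_def subgroup_generated_def SL2_prime_field_def)
  ultimately show ?thesis
    unfolding smash_algebra_def
    by (intro smash_product_ring)
       (simp_all add: transvection_group_group linear_act_1 linear_act_comp,
        simp_all add: linear_act_def subst_gens_add subst_gens_mult)
qed

lemma smash_of_group_mult_alg:
  assumes "group G" "finite (carrier G)" "h \<in> carrier G"
    and "act h 0 = 0" "act h 1 = 1" "act \<one>\<^bsub>G\<^esub> 0 = 0" "act \<one>\<^bsub>G\<^esub> 1 = 1"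
  shows "smash_of_group h \<otimes>\<^bsub>smash_product G act\<^esub> smash_of_alg G a
       = smash_of_alg G (act h a) \<otimes>\<^bsub>smash_product G act\<^esub> smash_of_group h"
proof -
  interpret G: group G by fact
  have *: "inv\<^bsub>G\<^esub> h \<otimes>\<^bsub>G\<^esub> h' = \<one>\<^bsub>G\<^esub> \<longleftrightarrow> h' = h" if "h' \<in> carrier G" for h'
    using assms(3) that by (metis G.inv_closed G.inv_equality G.inv_inv G.l_inv)
  have "(\<Sum>b\<in>carrier G. (if b = h then 1 else 0) * act b (smash_of_alg G a (inv\<^bsub>G\<^esub> b \<otimes>\<^bsub>G\<^esub> h')))
      = (if h' = h then act h a else 0)" if "h' \<in> carrier G" for h'
  proof -
    have "(\<Sum>b\<in>carrier G. (if b = h then 1 else 0) * act b (smash_of_alg G a (inv\<^bsub>G\<^esub> b \<otimes>\<^bsub>G\<^esub> h')))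
        = (\<Sum>b\<in>carrier G. if b = h then act b (smash_of_alg G a (inv\<^bsub>G\<^esub> b \<otimes>\<^bsub>G\<^esub> h')) else 0)"
      by (rule sum.cong) auto
    then show ?thesis using assms * that by (auto simp: smash_of_alg_def)
  qed
  moreover have "(\<Sum>b\<in>carrier G. (if b = \<one>\<^bsub>G\<^esub> then act h a else 0)
        * act b (if inv\<^bsub>G\<^esub> b \<otimes>\<^bsub>G\<^esub> h' = h then 1 else 0))
      = (if h' = h then act h a else 0)" if "h' \<in> carrier G" for h'
  proof -
    have "(\<Sum>b\<in>carrier G. (if b = \<one>\<^bsub>G\<^esub> then act h a else 0)
        * act b (if inv\<^bsub>G\<^esub> b \<otimes>\<^bsub>G\<^esub> h' = h then 1 else 0))
      = (\<Sum>b\<in>carrier G. if b = \<one>\<^bsub>G\<^esub> then act h a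
        * act b (if inv\<^bsub>G\<^esub> b \<otimes>\<^bsub>G\<^esub> h' = h then 1 else 0) else 0)"
      by (rule sum.cong) auto
    then show ?thesis using assms that by auto
  qed
  ultimately show ?thesis
    by (auto simp: smash_product_def smash_of_group_def smash_of_alg_def fun_eq_iff)
qed

end

theory Submission
  imports Defs
begin

text \<open>
  With \<open>A = k[x] \<otimes> kG\<close>, the algebra \<open>H\<^sub>\<lambda>\<close> is the skew polynomial ring \<open>A[y;\<delta>]\<close> with
  \<open>\<delta>(x) = - \<lambda>\<close> and \<open>\<delta>(g) = - x g\<close>. Its Jacobson radical \<open>J\<close> is stable under the automorphisms
  \<open>y \<mapsto> y + c\<close>; since \<open>k\<close> is infinite, a nonzero element of \<open>J\<close> of least degree in \<open>y\<close> is a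
  constant, so \<open>J \<inter> A\<close> is a nonzero \<open>\<delta>\<close>-stable ideal if \<open>J \<noteq> 0\<close>. As \<open>\<delta>\<close> lowers the order of vanishing
  at \<open>g = 1\<close>, this ideal contains some \<open>b\<close> with nonzero augmentation \<open>\<epsilon>(b) \<in> k[x]\<close>. Then
  \<open>(x b)^p = (x \<epsilon>(b))^p\<close> is a nonconstant polynomial in \<open>x^p\<close>, hence central, and
  \<open>1 - (x b)^p\<close> is not invertible because \<open>A[y;\<delta>]\<close> is free over \<open>k[x]\<close>. This contradicts \<open>(x b)^p \<in> J\<close>.
\<close>

section \<open>Maximal left ideals and the Jacobson radical\<close>

text \<open>The derivation is \<open>- (x g d/dg + \<lambda> d/dx)\<close>. Its second term acts on
  coefficients in \<open>k[x]\<close> and cannot lower the order of vanishing at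
  \<open>g = 1\<close>, so it cannot cancel the drop caused by the first. The moments, values at
  \<open>g = 1\<close> of iterates of \<open>g d/dg\<close>, record this order without choosing a
  basis of powers of \<open>g - 1\<close>. The factor \<open>x\<close> in \<open>x b\<close> makes
  the polynomial nonconstant even when \<epsilon>(b) is a nonzero scalar. The exponent
  \<open>p\<close> serves twice: the Frobenius map erases the group elements because
  \<open>g^p = 1\<close>, and p-th powers have derivative zero, so \<delta> kills the result. The
  delicate half of the presentation of H is injectivity: the ideal of the relator must exhaust the
  kernel. The smash product acts on normal forms with \<open>y\<close> on the right; a section
  \<open>sec\<close> writes a normal form back as an element of the smash product, and every
  \<open>u\<close> is shown congruent to \<open>sec (Psi u)\<close> modulo the relator.\<close>

lemma left_ideal_subset: "left_ideal I R \<Longrightarrow> I \<subseteq> carrier R"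
  by (simp add: left_ideal_def additive_subgroup.a_subset)

lemma left_ideal_mult:
  "left_ideal I R \<Longrightarrow> r \<in> carrier R \<Longrightarrow> a \<in> I \<Longrightarrow> r \<otimes>\<^bsub>R\<^esub> a \<in> I"
  by (simp add: left_ideal_def)

context ring
begin

lemma left_idealI:
  assumes "I \<subseteq> carrier R" "\<zero> \<in> I"
    and "\<And>a b. a \<in> I \<Longrightarrow> b \<in> I \<Longrightarrow> a \<oplus> b \<in> I"
    and "\<And>r a. r \<in> carrier R \<Longrightarrow> a \<in> I \<Longrightarrow> r \<otimes> a \<in> I"
  shows "left_ideal I R"
proof -
  have "\<ominus> a \<in> I" if "a \<in> I" for a
    using assms(4)[of "\<ominus> \<one>" a] that assms(1) l_minus[of \<one> a] by auto
  then have "additive_subgroup I R"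
    unfolding additive_subgroup_def using assms by (intro subgroup.intro) (auto simp: a_inv_def)
  then show ?thesis
    using assms by (simp add: left_ideal_def)
qed

lemma left_ideal_zero: "left_ideal I R \<Longrightarrow> \<zero> \<in> I"
  by (simp add: left_ideal_def additive_subgroup.zero_closed)

lemma left_ideal_add: "left_ideal I R \<Longrightarrow> a \<in> I \<Longrightarrow> b \<in> I \<Longrightarrow> a \<oplus> b \<in> I"
  by (simp add: left_ideal_def additive_subgroup.a_closed)

lemma left_ideal_minus: "left_ideal I R \<Longrightarrow> a \<in> I \<Longrightarrow> b \<in> I \<Longrightarrow> a \<ominus> b \<in> I"
  by (simp add: left_ideal_def additive_subgroup.a_closed additive_subgroup.a_inv_closed a_minus_def)

lemma left_ideal_eq_carrier: "left_ideal I R \<Longrightarrow> \<one> \<in> I \<Longrightarrow> I = carrier R"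
  using left_ideal_mult[of I R _ \<one>] left_ideal_subset[of I R] by auto

text \<open>Used with \<open>I\<close> a maximal left ideal, to exploit maximality, and with
  \<open>I\<close> zero, where it is the principal left ideal of \<open>a\<close>.\<close>

lemma left_ideal_generated:
  assumes I: "left_ideal I R" and a: "a \<in> carrier R"
  shows "left_ideal {r \<otimes> a \<oplus> b | r b. r \<in> carrier R \<and> b \<in> I} R" (is "left_ideal ?J R")
proof (rule left_idealI)
  note sub = subsetD[OF left_ideal_subset[OF I]]
  show "?J \<subseteq> carrier R"
    using a sub by auto
  show "\<zero> \<in> ?J"
    using a left_ideal_zero[OF I] by (intro CollectI exI[of _ \<zero>]) auto
  show "u \<oplus> v \<in> ?J" if "u \<in> ?J" "v \<in> ?J" for u v
  proof -
    from that obtain r b s c where "r \<in> carrier R" "s \<in> carrier R" "b \<in> I" "c \<in> I"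
      "u = r \<otimes> a \<oplus> b" "v = s \<otimes> a \<oplus> c" by blast
    moreover from this have "u \<oplus> v = (r \<oplus> s) \<otimes> a \<oplus> (b \<oplus> c)"
      using a sub by (simp add: l_distr a_ac)
    ultimately show ?thesis
      using left_ideal_add[OF I] by blast
  qed
  show "s \<otimes> u \<in> ?J" if "s \<in> carrier R" "u \<in> ?J" for s u
  proof -
    from that obtain r b where "r \<in> carrier R" "b \<in> I" "u = r \<otimes> a \<oplus> b" by blast
    moreover from this have "s \<otimes> u = (s \<otimes> r) \<otimes> a \<oplus> s \<otimes> b"
      using a sub that by (simp add: r_distr m_assoc)
    ultimately show ?thesis
      using left_ideal_mult[OF I] that by blast
  qed
qed

text \<open>Zorn's lemma applies because properness of a left ideal amounts to missing
  \<open>1\<close>, a condition that survives unions of chains.\<close>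

lemma exists_maximal_left_ideal:
  assumes I: "left_ideal I R" and proper: "I \<noteq> carrier R"
  shows "\<exists>M. maximal_left_ideal M R \<and> I \<subseteq> M"
proof -
  define F where "F = {L. left_ideal L R \<and> I \<subseteq> L \<and> \<one> \<notin> L}"
  have "I \<in> F"
    using I proper left_ideal_eq_carrier by (auto simp: F_def)
  moreover have "\<Union>C \<in> F" if "C \<noteq> {}" "subset.chain F C" for C
  proof -
    have C: "C \<subseteq> F" and chain: "\<And>K L. K \<in> C \<Longrightarrow> L \<in> C \<Longrightarrow> K \<subseteq> L \<or> L \<subseteq> K"
      using that(2) by (auto simp: subset.chain_def)
    have LI: "left_ideal L R" if "L \<in> C" for L
      using C that by (auto simp: F_def)
    have "left_ideal (\<Union>C) R"
    proof (rule left_idealI)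
      show "\<Union>C \<subseteq> carrier R"
        using LI left_ideal_subset by blast
      show "\<zero> \<in> \<Union>C"
        using LI left_ideal_zero \<open>C \<noteq> {}\<close> by blast
      show "a \<oplus> b \<in> \<Union>C" if "a \<in> \<Union>C" "b \<in> \<Union>C" for a b
      proof -
        from that obtain K L where *: "K \<in> C" "L \<in> C" "a \<in> K" "b \<in> L" by blast
        with chain[of K L] have "\<exists>N\<in>C. a \<in> N \<and> b \<in> N" by blast
        then show ?thesis
          using left_ideal_add[OF LI] by blast
      qed
      show "r \<otimes> a \<in> \<Union>C" if "r \<in> carrier R" "a \<in> \<Union>C" for r a
        using left_ideal_mult[OF LI that(1)] that(2) by blast
    qed
    then show ?thesis
      using C \<open>C \<noteq> {}\<close> by (auto simp: F_def)
  qed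
  ultimately obtain M where M: "M \<in> F" and max: "\<And>L. L \<in> F \<Longrightarrow> M \<subseteq> L \<Longrightarrow> L = M"
    using subset_Zorn_nonempty[of F] by blast
  have "maximal_left_ideal M R"
    unfolding maximal_left_ideal_def
  proof (intro conjI allI impI)
    show "left_ideal M R" "M \<noteq> carrier R"
      using M by (auto simp: F_def)
    fix L assume "left_ideal L R \<and> M \<subseteq> L"
    then show "L = M \<or> L = carrier R"
      using max[of L] M left_ideal_eq_carrier[of L] by (auto simp: F_def)
  qed
  then show ?thesis
    using M by (auto simp: F_def)
qed

lemma jacobson_radical_left_ideal: "left_ideal (jacobson_radical R) R"
  by (rule left_idealI)
     (simp_all add: jacobson_radical_def maximal_left_ideal_def
       left_ideal_zero left_ideal_add left_ideal_mult)

lemma jacobson_radical_subset: "jacobson_radical R \<subseteq> carrier R"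
  by (simp add: jacobson_radical_def)

text \<open>
  For a maximal left ideal \<open>M\<close> and \<open>r \<notin> M\<close>, the set \<open>{s. s r \<in> M}\<close> is the annihilator of the
  class of \<open>r\<close> in the simple module \<open>R/M\<close>, hence again a maximal left ideal.
\<close>

lemma maximal_left_ideal_quotient:
  assumes M: "maximal_left_ideal M R" and r: "r \<in> carrier R" "r \<notin> M"
  shows "maximal_left_ideal {s \<in> carrier R. s \<otimes> r \<in> M} R" (is "maximal_left_ideal ?Q R")
proof -
  have MI: "left_ideal M R"
    using M by (simp add: maximal_left_ideal_def)
  show ?thesis
    unfolding maximal_left_ideal_def
  proof (intro conjI allI impI)
    show "left_ideal ?Q R"
      by (rule left_idealI)
         (use r left_ideal_zero[OF MI] left_ideal_add[OF MI] left_ideal_mult[OF MI] in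
           \<open>auto simp: l_distr m_assoc\<close>)
    have "\<one> \<notin> ?Q"
      using r by simp
    then show "?Q \<noteq> carrier R"
      by blast
    fix L assume L: "left_ideal L R \<and> ?Q \<subseteq> L"
    show "L = ?Q \<or> L = carrier R"
    proof (rule disjCI)
      assume "L \<noteq> carrier R"
      have "l \<in> ?Q" if l: "l \<in> L" for l
      proof (rule ccontr)
        assume "l \<notin> ?Q"
        note Lsub = subsetD[OF left_ideal_subset[of L R]]
        have lc: "l \<in> carrier R"
          using L l Lsub by blast
        with \<open>l \<notin> ?Q\<close> have notM: "l \<otimes> r \<notin> M" by simp
        let ?N = "{t \<otimes> (l \<otimes> r) \<oplus> b | t b. t \<in> carrier R \<and> b \<in> M}"
        have N: "left_ideal ?N R"
          using left_ideal_generated[OF MI, of "l \<otimes> r"] lc r by blast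
        have "b \<in> ?N" if "b \<in> M" for b
          using that lc r left_ideal_subset[OF MI] by (intro CollectI exI[of _ \<zero>] exI[of _ b]) auto
        moreover have "l \<otimes> r \<in> ?N"
          using lc r left_ideal_zero[OF MI] by (intro CollectI exI[of _ \<one>] exI[of _ \<zero>]) auto
        \<comment> \<open>Maximality of \<open>M\<close> yields \<open>r = t l r + b\<close> with
          \<open>b\<close> in \<open>M\<close>. Hence \<open>1 - t l\<close> sends \<open>r\<close>
          into \<open>M\<close>, so it lies in \<open>?Q\<close> and in \<open>L\<close>; adding
          \<open>t l\<close> puts \<open>1\<close> in \<open>L\<close>.\<close>
        ultimately have "?N = carrier R"
          using M N notM unfolding maximal_left_ideal_def by blast
        then obtain t b where tb: "t \<in> carrier R" "b \<in> M" "r = t \<otimes> (l \<otimes> r) \<oplus> b"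
          using r by blast
        have bc: "b \<in> carrier R"
          using tb left_ideal_subset[OF MI] by blast
        have "(\<one> \<ominus> t \<otimes> l) \<otimes> r = r \<ominus> t \<otimes> (l \<otimes> r)"
          using tb(1) lc r by (simp add: a_minus_def l_distr l_minus m_assoc)
        also have "\<dots> = t \<otimes> (l \<otimes> r) \<oplus> b \<ominus> t \<otimes> (l \<otimes> r)"
          using tb(3) by simp
        also have "\<dots> = b"
          using tb(1) lc r bc by (simp add: a_minus_def a_comm[of _ b] a_assoc r_neg)
        finally have "\<one> \<ominus> t \<otimes> l \<in> ?Q"
          using tb lc by simp
        then have "\<one> \<ominus> t \<otimes> l \<in> L"
          using L by blast
        then have "(\<one> \<ominus> t \<otimes> l) \<oplus> t \<otimes> l \<in> L"
          using left_ideal_add left_ideal_mult[of L R t l] L l tb(1) by simp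
        moreover have "(\<one> \<ominus> t \<otimes> l) \<oplus> t \<otimes> l = \<one>"
          using tb(1) lc by (simp add: a_minus_def a_assoc l_neg)
        ultimately show False
          using left_ideal_eq_carrier[of L] L \<open>L \<noteq> carrier R\<close> by simp
      qed
      then show "L = ?Q"
        using L by blast
    qed
  qed
qed

text \<open>An intersection of left ideals need not absorb factors on the right. Here
  \<open>a r\<close> lies in \<open>M\<close> because \<open>a\<close> lies in the maximal left
  ideal of all \<open>s\<close> with \<open>s r\<close> in \<open>M\<close>.\<close>

lemma jacobson_radical_mult_right:
  assumes a: "a \<in> jacobson_radical R" and r: "r \<in> carrier R"
  shows "a \<otimes> r \<in> jacobson_radical R"
proof -
  have "a \<otimes> r \<in> M" if M: "maximal_left_ideal M R" for M
  proof (cases "r \<in> M")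
    case True
    then show ?thesis
      using M a left_ideal_mult[of M R] by (auto simp: maximal_left_ideal_def jacobson_radical_def)
  next
    case False
    then show ?thesis
      using maximal_left_ideal_quotient[OF M r] a by (auto simp: jacobson_radical_def)
  qed
  then show ?thesis
    using a r by (auto simp: jacobson_radical_def)
qed

text \<open>Otherwise the left ideal generated by \<open>1 - a\<close> lies in a maximal one, which
  also contains \<open>a\<close> and therefore \<open>1\<close>.\<close>

lemma jacobson_radical_left_inverse:
  assumes a: "a \<in> jacobson_radical R"
  shows "\<exists>h\<in>carrier R. h \<otimes> (\<one> \<ominus> a) = \<one>"
proof (rule ccontr)
  assume no: "\<not> ?thesis"
  have ac: "a \<in> carrier R"
    using a by (simp add: jacobson_radical_def)
  let ?I = "{r \<otimes> (\<one> \<ominus> a) \<oplus> b | r b. r \<in> carrier R \<and> b \<in> {\<zero>}}"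
  have I: "left_ideal ?I R"
    by (rule left_ideal_generated) (use ac in \<open>auto intro!: left_idealI\<close>)
  have "\<one> \<notin> ?I"
    using no ac by auto
  then obtain M where M: "maximal_left_ideal M R" "?I \<subseteq> M"
    using exists_maximal_left_ideal[OF I] by blast
  have MI: "left_ideal M R"
    using M by (simp add: maximal_left_ideal_def)
  have "\<one> \<ominus> a \<in> ?I"
    using ac by (intro CollectI exI[of _ \<one>] exI[of _ \<zero>]) auto
  moreover have "a \<in> M"
    using a M by (auto simp: jacobson_radical_def)
  ultimately have "(\<one> \<ominus> a) \<oplus> a \<in> M"
    using M left_ideal_add[OF MI] by blast
  moreover have "(\<one> \<ominus> a) \<oplus> a = \<one>"
    using ac by (simp add: a_minus_def a_assoc l_neg)
  ultimately show False
    using left_ideal_eq_carrier[OF MI] M by (simp add: maximal_left_ideal_def)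
qed

end

text \<open>Maximal left ideals pull back to maximal left ideals. This serves both for the
  translations in \<open>y\<close> and for the passage from H to the skew polynomial ring.\<close>

lemma jacobson_radical_ring_iso:
  assumes R: "ring R" and S: "ring S" and phi: "\<phi> \<in> ring_iso R S"
    and a: "a \<in> jacobson_radical R"
  shows "\<phi> a \<in> jacobson_radical S"
proof -
  interpret R: ring R by (rule R)
  interpret S: ring S by (rule S)
  note [simp] = ring_iso_memE(1,2,3)[OF phi]
  have zero [simp]: "\<phi> \<zero>\<^bsub>R\<^esub> = \<zero>\<^bsub>S\<^esub>"
    using phi R S ring_hom_zero by (fastforce simp: ring_iso_def)
  have bij: "bij_betw \<phi> (carrier R) (carrier S)"
    by (rule ring_iso_memE(5)[OF phi])
  then have surj: "\<phi> ` carrier R = carrier S" and inj: "inj_on \<phi> (carrier R)"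
    by (simp_all add: bij_betw_def)
  have "\<phi> a \<in> M" if M: "maximal_left_ideal M S" for M
  proof -
    let ?P = "{r \<in> carrier R. \<phi> r \<in> M}"
    have MI: "left_ideal M S" and Msub: "M \<subseteq> carrier S"
      using M left_ideal_subset by (auto simp: maximal_left_ideal_def)
    have img: "\<phi> ` ?P = M"
      using surj Msub by auto
    have "maximal_left_ideal ?P R"
      unfolding maximal_left_ideal_def
    proof (intro conjI allI impI)
      show "left_ideal ?P R"
        by (rule R.left_idealI)
           (use S.left_ideal_zero[OF MI] S.left_ideal_add[OF MI] left_ideal_mult[OF MI] in auto)
      show "?P \<noteq> carrier R"
        using M img surj by (auto simp: maximal_left_ideal_def)
      fix L assume L: "left_ideal L R \<and> ?P \<subseteq> L"
      then have Lsub: "L \<subseteq> carrier R"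
        using left_ideal_subset by blast
      have "left_ideal (\<phi> ` L) S"
      proof (rule S.left_idealI)
        show "\<phi> ` L \<subseteq> carrier S"
          using Lsub by auto
        show "\<zero>\<^bsub>S\<^esub> \<in> \<phi> ` L"
          using L R.left_ideal_zero zero by (metis imageI)
        show "u \<oplus>\<^bsub>S\<^esub> v \<in> \<phi> ` L" if uv: "u \<in> \<phi> ` L" "v \<in> \<phi> ` L" for u v
        proof -
          from uv obtain b c where "b \<in> L" "c \<in> L" "u = \<phi> b" "v = \<phi> c" by blast
          moreover from this have "u \<oplus>\<^bsub>S\<^esub> v = \<phi> (b \<oplus>\<^bsub>R\<^esub> c)"
            using Lsub by (simp add: subset_iff)
          ultimately show ?thesis
            using L R.left_ideal_add by blast
        qed
        show "r \<otimes>\<^bsub>S\<^esub> u \<in> \<phi> ` L" if ru: "r \<in> carrier S" "u \<in> \<phi> ` L" for r u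
        proof -
          from ru surj obtain s b where "s \<in> carrier R" "b \<in> L" "r = \<phi> s" "u = \<phi> b" by blast
          moreover from this have "r \<otimes>\<^bsub>S\<^esub> u = \<phi> (s \<otimes>\<^bsub>R\<^esub> b)"
            using Lsub by (simp add: subset_iff)
          moreover have "s \<otimes>\<^bsub>R\<^esub> b \<in> L"
            using L \<open>s \<in> carrier R\<close> \<open>b \<in> L\<close> by (simp add: left_ideal_mult)
          ultimately show ?thesis
            by simp
        qed
      qed
      moreover have "M \<subseteq> \<phi> ` L"
        using img L by blast
      ultimately have "\<phi> ` L = \<phi> ` ?P \<or> \<phi> ` L = \<phi> ` carrier R"
        using M unfolding img surj by (auto simp: maximal_left_ideal_def)
      then show "L = ?P \<or> L = carrier R"
        using inj_on_image_eq_iff[OF inj] Lsub by blast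
    qed
    then show ?thesis
      using a by (auto simp: jacobson_radical_def)
  qed
  moreover have "\<phi> a \<in> carrier S"
    using a by (simp add: jacobson_radical_def)
  ultimately show ?thesis
    by (auto simp: jacobson_radical_def)
qed

section \<open>Skew polynomials over the group algebra\<close>

lemma poly_mapping_sum_single:
  fixes f :: "'a \<Rightarrow>\<^sub>0 'b::comm_monoid_add"
  shows "f = (\<Sum>x\<in>Poly_Mapping.keys f. Poly_Mapping.single x (Poly_Mapping.lookup f x))"
  by (rule poly_mapping_eqI) (auto simp: lookup_sum lookup_single when_def in_keys_iff)

lemma poly_mapping_induct_single [case_names zero single add]:
  fixes f :: "'a \<Rightarrow>\<^sub>0 'b::comm_monoid_add"
  assumes "P 0" and "\<And>x c. P (Poly_Mapping.single x c)"
    and "\<And>f g. P f \<Longrightarrow> P g \<Longrightarrow> P (f + g)"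
  shows "P f"
proof -
  have "P (\<Sum>x\<in>A. Poly_Mapping.single x (Poly_Mapping.lookup f x))" if "finite A" for A
    using that by (induction A) (simp_all add: assms)
  then show ?thesis
    by (metis finite_keys poly_mapping_sum_single)
qed

lemma smult_sum_right: "smult a (sum f A) = (\<Sum>i\<in>A. smult a (f i))"
  by (induction A rule: infinite_finite_induct) (simp_all add: smult_add_right)

text \<open>Euclid's argument: over a finite field, one plus the product of all \<open>X - a\<close>
  takes the value \<open>1\<close> everywhere and so has no root.\<close>

lemma infinite_UNIV_alg_closed: "infinite (UNIV :: 'a::alg_closed_field set)"
proof
  assume fin: "finite (UNIV :: 'a set)"
  let ?q = "(\<Prod>a\<in>UNIV. [:-a, 1:]) + 1 :: 'a poly"
  have deg: "degree (\<Prod>a\<in>UNIV. [:-a, 1:] :: 'a poly) = card (UNIV :: 'a set)"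
    by (subst degree_prod_eq_sum_degree) simp_all
  have "card (UNIV :: 'a set) > 0"
    using fin by (simp add: card_gt_0_iff)
  then have "degree ?q > 0"
    using deg by (subst degree_add_eq_left) simp_all
  then obtain x where "poly ?q x = 0"
    using alg_closed_imp_poly_has_root by blast
  moreover have "poly ?q x = 1"
    using fin by (auto simp: poly_prod)
  ultimately show False by simp
qed

text \<open>Extends maps given on monomials: \<open>F i a\<close> is the intended image of the term
  with coefficient \<open>a\<close> in degree \<open>i\<close>. Later uses put noncommuting factors
  into \<open>F\<close>, which rules out \<open>poly\<close>.\<close>

definition poly_lin :: "(nat \<Rightarrow> 'a \<Rightarrow> 'b) \<Rightarrow> 'a::zero poly \<Rightarrow> 'b::comm_monoid_add" where
  "poly_lin F f = (\<Sum>i\<le>degree f. F i (coeff f i))"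

lemma poly_lin_bound:
  assumes "\<And>i. F i 0 = 0" "degree f \<le> n"
  shows "poly_lin F f = (\<Sum>i\<le>n. F i (coeff f i))"
  unfolding poly_lin_def using assms
  by (intro sum.mono_neutral_left) (auto simp: coeff_eq_0)

lemma poly_lin_add:
  assumes "\<And>i. F i 0 = 0" "\<And>i a b. F i (a + b) = F i a + F i b"
  shows "poly_lin F (f + g) = poly_lin F f + poly_lin F g"
proof -
  let ?n = "max (degree f) (degree g)"
  have "degree (f + g) \<le> ?n"
    by (rule degree_add_le_max)
  then show ?thesis
    by (simp add: poly_lin_bound[of F _ ?n] assms sum.distrib)
qed

lemma poly_lin_pCons:
  assumes "\<And>i. F i 0 = 0"
  shows "poly_lin F (pCons a f) = F 0 a + poly_lin (\<lambda>i. F (Suc i)) f"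
  by (subst poly_lin_bound[of F, OF assms degree_pCons_le])
     (simp add: sum.atMost_Suc_shift poly_lin_def del: sum.atMost_Suc)

lemma poly_lin_smult:
  assumes "\<And>i. F i 0 = 0"
  shows "poly_lin F (smult a f) = poly_lin (\<lambda>i b. F i (a * b)) f"
  by (subst poly_lin_bound[of F, OF assms degree_smult_le]) (simp add: poly_lin_def)

lemma poly_lin_monom:
  assumes "\<And>i. F i 0 = 0"
  shows "poly_lin F (monom a n) = F n a"
proof -
  have "poly_lin F (monom a n) = (\<Sum>i\<le>n. F i (coeff (monom a n) i))"
    by (rule poly_lin_bound) (simp_all add: assms degree_monom_le)
  also have "\<dots> = (\<Sum>i\<le>n. if i = n then F n a else 0)"
    by (rule sum.cong) (auto simp: assms)
  finally show ?thesis
    by simp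
qed

text \<open>
  In the group algebra of the additive group of \<open>k\<close> every group element has order dividing
  \<open>char k\<close>, and the elements of the prime field form the copy of \<open>G\<close> sending
  a unipotent matrix to its upper right entry. A coefficient \<open>Poly_Mapping.single c q\<close>
  therefore stands for \<open>q(x) g^c\<close>.
\<close>

type_synonym 'k coef = "'k \<Rightarrow>\<^sub>0 'k poly"

definition var_x :: "'k::field coef" where
  "var_x = Poly_Mapping.single 0 [:0, 1:]"

definition const :: "'k \<Rightarrow> 'k::field coef" where
  "const c = Poly_Mapping.single 0 [:c:]"

text \<open>The derivation \<open>g d/dg\<close>, with \<open>g^c\<close> as eigenvector of
  eigenvalue \<open>c\<close>. Taking the exponents in \<open>k\<close> lets one \<open>c\<close>
  serve as group element and as scalar.\<close>

definition charge :: "'k coef \<Rightarrow> 'k::field coef" where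
  "charge = Poly_Mapping.mapp smult"

definition xderiv :: "'k coef \<Rightarrow> 'k::field coef" where
  "xderiv = Poly_Mapping.map pderiv"

lemma lookup_charge [simp]:
  "Poly_Mapping.lookup (charge a) c = smult c (Poly_Mapping.lookup a c)"
  by (simp add: charge_def lookup_mapp when_def in_keys_iff)

lemma lookup_xderiv [simp]:
  "Poly_Mapping.lookup (xderiv a) c = pderiv (Poly_Mapping.lookup a c)"
  by (simp add: xderiv_def Poly_Mapping.map.rep_eq when_def)

lemma charge_add: "charge (a + b) = charge a + charge b"
  by (rule poly_mapping_eqI) (simp add: lookup_add smult_add_right)

lemma xderiv_add: "xderiv (a + b) = xderiv a + xderiv b"
  by (rule poly_mapping_eqI) (simp add: lookup_add pderiv_add)

lemma charge_single [simp]: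
  "charge (Poly_Mapping.single c q) = Poly_Mapping.single c (smult c q)"
  by (rule poly_mapping_eqI) (simp add: lookup_single when_def)

lemma xderiv_single [simp]:
  "xderiv (Poly_Mapping.single c q) = Poly_Mapping.single c (pderiv q)"
  by (rule poly_mapping_eqI) (simp add: lookup_single when_def)

lemma charge_0 [simp]: "charge 0 = 0" and xderiv_0 [simp]: "xderiv 0 = 0"
  by (rule poly_mapping_eqI; simp)+

lemma charge_mult: "charge (a * b) = charge a * b + a * charge b"
proof (induction a rule: poly_mapping_induct_single)
  case (single c q)
  show ?case
  proof (induction b rule: poly_mapping_induct_single)
    case (single d r)
    show ?case
      by (simp add: mult_single smult_add_left single_add)
  qed (simp_all add: distrib_left charge_add)
qed (simp_all add: distrib_right charge_add)

lemma xderiv_mult: "xderiv (a * b) = xderiv a * b + a * xderiv b"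
proof (induction a rule: poly_mapping_induct_single)
  case (single c q)
  show ?case
  proof (induction b rule: poly_mapping_induct_single)
    case (single d r)
    show ?case
      by (simp add: mult_single pderiv_mult single_add algebra_simps)
  qed (simp_all add: distrib_left xderiv_add)
qed (simp_all add: distrib_right xderiv_add)

definition prime_field :: "'k::field set" where
  "prime_field = range of_nat"

text \<open>The algebra A itself, cut out of the larger group algebra of the additive group of
  \<open>k\<close>.\<close>

definition coef_ring :: "'k::field coef set" where
  "coef_ring = {a. Poly_Mapping.keys a \<subseteq> prime_field}"

lemma prime_field_add: "c \<in> prime_field \<Longrightarrow> d \<in> prime_field \<Longrightarrow> c + d \<in> prime_field"
  by (auto simp: prime_field_def simp flip: of_nat_add)

lemma of_nat_in_prime_field [simp]: "of_nat n \<in> prime_field"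
  and zero_in_prime_field [simp]: "0 \<in> prime_field"
  unfolding prime_field_def by (auto intro: range_eqI[of _ _ 0])

lemma coef_ring_add: "a \<in> coef_ring \<Longrightarrow> b \<in> coef_ring \<Longrightarrow> a + b \<in> coef_ring"
  using keys_add[of a b] by (auto simp: coef_ring_def)

lemma coef_ring_mult: "a \<in> coef_ring \<Longrightarrow> b \<in> coef_ring \<Longrightarrow> a * b \<in> coef_ring"
  using keys_mult[of a b] by (fastforce simp: coef_ring_def intro: prime_field_add)

lemma coef_ring_uminus [simp]: "- a \<in> coef_ring \<longleftrightarrow> a \<in> coef_ring"
  by (simp add: coef_ring_def in_keys_iff subset_iff)

lemma coef_ring_zero [simp]: "0 \<in> coef_ring"
  by (simp add: coef_ring_def)

lemma coef_ring_sum: "(\<And>i. i \<in> A \<Longrightarrow> f i \<in> coef_ring) \<Longrightarrow> sum f A \<in> coef_ring"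
  by (induction A rule: infinite_finite_induct) (simp_all add: coef_ring_add)

lemma coef_ring_charge: "a \<in> coef_ring \<Longrightarrow> charge a \<in> coef_ring"
  by (auto simp: coef_ring_def in_keys_iff subset_iff)

lemma coef_ring_xderiv: "a \<in> coef_ring \<Longrightarrow> xderiv a \<in> coef_ring"
  by (simp add: coef_ring_def in_keys_iff subset_iff) (metis pderiv_0)

lemma coef_ring_single [simp]: "c \<in> prime_field \<Longrightarrow> Poly_Mapping.single c q \<in> coef_ring"
  by (auto simp: coef_ring_def)

lemma coef_ring_one [simp]: "1 \<in> coef_ring"
  unfolding single_one[symmetric] by (rule coef_ring_single) simp

lemma coef_ring_var_x [simp]: "var_x \<in> coef_ring"
  and coef_ring_const [simp]: "const c \<in> coef_ring"
  by (simp_all add: var_x_def const_def)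

lemma const_add: "const (a + b) = const a + const b"
  and const_0 [simp]: "const 0 = 0"
  and const_1 [simp]: "const 1 = 1"
  by (simp_all add: const_def pCons_one flip: single_add)

section \<open>Multiplication and translations of skew polynomials\<close>

type_synonym 'k skew = "'k coef poly"

text \<open>
  The skew polynomial ring \<open>A[y;\<delta>]\<close>, where \<open>\<delta>(g^c) = - c x g^c\<close> and
  \<open>\<delta>(x) = - \<lambda>\<close> encode \<open>y g - g y = - x g\<close> and \<open>y x - x y = - \<lambda>\<close>. Its elements are written with
  the powers of \<open>y\<close> on the right, and left multiplication by \<open>y\<close> is \<open>ymult\<close>.
\<close>

locale skew_poly =
  fixes L :: "'k::field coef"
  assumes L: "L \<in> coef_ring"
begin

definition der :: "'k coef \<Rightarrow> 'k coef" where
  "der a = - (var_x * charge a + L * xderiv a)"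

lemma der_add: "der (a + b) = der a + der b"
  by (simp add: der_def charge_add xderiv_add algebra_simps)

lemma der_mult: "der (a * b) = der a * b + a * der b"
  by (simp add: der_def charge_mult xderiv_mult algebra_simps)

lemma der_0 [simp]: "der 0 = 0"
  using der_add[of 0 0] by simp

lemma der_1 [simp]: "der 1 = 0"
  using der_mult[of 1 1] by simp

lemma der_var_x: "der var_x = - L"
  by (simp add: der_def var_x_def pderiv_pCons flip: one_pCons)

lemma der_group: "der (Poly_Mapping.single c 1) = - (const c * var_x * Poly_Mapping.single c 1)"
  by (simp add: der_def var_x_def const_def mult_single)

lemma der_const [simp]: "der (const c) = 0"
  by (simp add: der_def const_def pderiv_pCons)

lemma coef_ring_der: "a \<in> coef_ring \<Longrightarrow> der a \<in> coef_ring"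
  unfolding der_def coef_ring_uminus
  by (simp add: coef_ring_add coef_ring_mult coef_ring_charge coef_ring_xderiv L)

text \<open>From \<open>y a = a y + \<delta>(a)\<close>: the map on coefficients accounts for
  \<delta>, the shift for the extra factor \<open>y\<close> on the right.\<close>

definition ymult :: "'k skew \<Rightarrow> 'k skew" where
  "ymult v = map_poly der v + pCons 0 v"

lemma coeff_ymult:
  "coeff (ymult v) n =
     der (coeff v n) + (case n of 0 \<Rightarrow> 0 | Suc m \<Rightarrow> coeff v m)"
  by (simp add: ymult_def coeff_map_poly coeff_pCons)

lemma ymult_add: "ymult (u + v) = ymult u + ymult v"
  by (rule poly_eqI) (simp add: coeff_ymult der_add split: nat.split)

lemma ymult_0 [simp]: "ymult 0 = 0"
  using ymult_add[of 0 0] by simp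

lemma ymult_smult:
  "ymult (smult a v) = smult (der a) v + smult a (ymult v)"
  by (rule poly_eqI) (simp add: coeff_ymult der_mult algebra_simps split: nat.split)

lemma ymult_monom: "der a = 0 \<Longrightarrow> ymult (monom a n) = monom a (Suc n)"
  by (rule poly_eqI) (auto simp: coeff_ymult split: nat.split)

lemma funpow_ymult_add: "(ymult ^^ n) (u + v) = (ymult ^^ n) u + (ymult ^^ n) v"
  by (induction n) (simp_all add: ymult_add)

lemma funpow_ymult_0 [simp]: "(ymult ^^ n) 0 = 0"
  by (induction n) simp_all

lemma funpow_ymult_const: "der a = 0 \<Longrightarrow> (ymult ^^ n) [:a:] = monom a n"
  by (induction n) (simp_all add: ymult_monom monom_0)

text \<open>The left factor acts on the right one as an operator, each \<open>y\<close> through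
  \<open>ymult\<close>. Linearity over A on the left is then immediate, and associativity is what
  has to be proved.\<close>

definition skew_mult :: "'k skew \<Rightarrow> 'k skew \<Rightarrow> 'k skew" where
  "skew_mult f v = poly_lin (\<lambda>i a. smult a ((ymult ^^ i) v)) f"

lemma skew_mult_0_left [simp]: "skew_mult 0 v = 0"
  by (simp add: skew_mult_def poly_lin_def)

lemma skew_mult_add_left: "skew_mult (f + g) v = skew_mult f v + skew_mult g v"
  unfolding skew_mult_def by (rule poly_lin_add) (simp_all add: smult_add_left)

lemma skew_mult_add_right: "skew_mult f (u + v) = skew_mult f u + skew_mult f v"
  by (simp add: skew_mult_def poly_lin_def funpow_ymult_add smult_add_right sum.distrib)

lemma skew_mult_smult_left: "skew_mult (smult a f) v = smult a (skew_mult f v)"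
  by (simp add: skew_mult_def poly_lin_smult) (simp add: poly_lin_def smult_sum_right)

lemma skew_mult_pCons: "skew_mult (pCons a f) v = smult a v + skew_mult f (ymult v)"
  by (simp add: skew_mult_def poly_lin_pCons funpow_swap1)

lemma skew_mult_const_left [simp]: "skew_mult [:a:] v = smult a v"
  by (simp add: skew_mult_pCons)

lemma skew_mult_one_left [simp]: "skew_mult 1 v = v"
  by (simp add: one_pCons)

text \<open>Elements of A killed by \<delta> commute with \<open>y\<close>, and A is commutative, so
  they are central.\<close>

lemma skew_mult_const_right:
  assumes "der a = 0"
  shows "skew_mult f [:a:] = smult a f"
proof -
  have "skew_mult f [:a:] = smult a (\<Sum>i\<le>degree f. monom (coeff f i) i)"
    by (simp add: skew_mult_def poly_lin_def funpow_ymult_const assms smult_monom smult_sum_right mult.commute)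
  then show ?thesis
    by (simp add: poly_as_sum_of_monoms)
qed

lemma skew_mult_one_right [simp]: "skew_mult f 1 = f"
  using skew_mult_const_right[of 1 f] by (simp add: one_pCons)

lemma skew_mult_y_left: "skew_mult [:0, 1:] v = ymult v"
  by (simp add: skew_mult_pCons)

text \<open>The core of associativity, resting on the Leibniz rule. The induction reads
  \<open>pCons a f\<close> as \<open>a + f y\<close>, with \<open>y\<close> split off on the
  right.\<close>

lemma ymult_skew_mult: "ymult (skew_mult f v) = skew_mult (ymult f) v"
proof (induction f arbitrary: v)
  case (pCons a f)
  have "ymult (pCons a f) = pCons (der a) (ymult f) + [:0, a:]"
    by (rule poly_eqI) (auto simp: coeff_ymult coeff_pCons split: nat.split)
  then show ?case
    by (simp add: skew_mult_pCons skew_mult_add_left ymult_add ymult_smult pCons.IH)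
qed simp

lemma skew_mult_assoc: "skew_mult (skew_mult f g) v = skew_mult f (skew_mult g v)"
proof (induction f arbitrary: g)
  case (pCons a f)
  then show ?case
    by (simp add: skew_mult_pCons skew_mult_add_left skew_mult_smult_left ymult_skew_mult)
qed simp

definition skew_carrier :: "'k skew set" where
  "skew_carrier = {f. \<forall>i. coeff f i \<in> coef_ring}"

lemma skew_carrier_coeff: "f \<in> skew_carrier \<Longrightarrow> coeff f i \<in> coef_ring"
  by (simp add: skew_carrier_def)

lemma skew_carrier_add: "f \<in> skew_carrier \<Longrightarrow> g \<in> skew_carrier \<Longrightarrow> f + g \<in> skew_carrier"
  by (simp add: skew_carrier_def coef_ring_add)

lemma skew_carrier_sum: "(\<And>i. i \<in> A \<Longrightarrow> f i \<in> skew_carrier) \<Longrightarrow> sum f A \<in> skew_carrier"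
  by (simp add: skew_carrier_def coeff_sum coef_ring_sum)

lemma skew_carrier_smult:
  "a \<in> coef_ring \<Longrightarrow> f \<in> skew_carrier \<Longrightarrow> smult a f \<in> skew_carrier"
  by (simp add: skew_carrier_def coef_ring_mult)

lemma skew_carrier_uminus [simp]: "- f \<in> skew_carrier \<longleftrightarrow> f \<in> skew_carrier"
  by (simp add: skew_carrier_def)

lemma skew_carrier_pCons [simp]:
  "pCons a f \<in> skew_carrier \<longleftrightarrow> a \<in> coef_ring \<and> f \<in> skew_carrier"
  by (auto simp: skew_carrier_def coeff_pCons split: nat.splits)

lemma skew_carrier_0 [simp]: "0 \<in> skew_carrier"
  and skew_carrier_1 [simp]: "1 \<in> skew_carrier"
  by (simp_all add: skew_carrier_def coeff_1)

lemma skew_carrier_ymult: "f \<in> skew_carrier \<Longrightarrow> ymult f \<in> skew_carrier"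
  by (auto simp: skew_carrier_def coeff_ymult coef_ring_der intro!: coef_ring_add split: nat.split)

lemma skew_carrier_mult: "f \<in> skew_carrier \<Longrightarrow> g \<in> skew_carrier \<Longrightarrow> skew_mult f g \<in> skew_carrier"
proof (induction f arbitrary: g)
  case (pCons a f)
  then show ?case
    by (simp add: skew_mult_pCons skew_carrier_add skew_carrier_smult skew_carrier_ymult)
qed simp

definition skew_ring :: "'k skew ring" where
  "skew_ring = \<lparr>carrier = skew_carrier, monoid.mult = skew_mult, one = 1, zero = 0, add = (+)\<rparr>"

lemma skew_ring_simps [simp]:
  "carrier skew_ring = skew_carrier" "u \<otimes>\<^bsub>skew_ring\<^esub> v = skew_mult u v"
  "\<one>\<^bsub>skew_ring\<^esub> = 1" "\<zero>\<^bsub>skew_ring\<^esub> = 0" "u \<oplus>\<^bsub>skew_ring\<^esub> v = u + v"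
  by (simp_all add: skew_ring_def)

lemma skew_ring_ring: "ring skew_ring"
proof (rule ringI)
  show "abelian_group skew_ring"
  proof (rule abelian_groupI)
    show "\<exists>v\<in>carrier skew_ring. v \<oplus>\<^bsub>skew_ring\<^esub> u = \<zero>\<^bsub>skew_ring\<^esub>" if "u \<in> carrier skew_ring" for u
      by (rule bexI[of _ "- u"]) (use that in simp_all)
  qed (simp_all add: skew_carrier_add add_ac)
  show "Group.monoid skew_ring"
    by (rule monoidI) (simp_all add: skew_carrier_mult skew_mult_assoc)
qed (simp_all add: skew_mult_add_left skew_mult_add_right)

lemma skew_ring_a_inv [simp]: "u \<in> skew_carrier \<Longrightarrow> \<ominus>\<^bsub>skew_ring\<^esub> u = - u"
  using abelian_group.minus_equality[OF ring.is_abelian_group[OF skew_ring_ring], of "- u" u] by simp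

lemma skew_ring_minus [simp]: "v \<in> skew_carrier \<Longrightarrow> u \<ominus>\<^bsub>skew_ring\<^esub> v = u - v"
  by (simp add: a_minus_def)

text \<open>The substitution of \<open>y + c\<close> for \<open>y\<close>. Commutative composition
  computes it correctly because \<open>const c\<close> is killed by \<delta>, so the powers of
  \<open>y + c\<close> expand as in a commutative ring.\<close>

definition translate :: "'k \<Rightarrow> 'k skew \<Rightarrow> 'k skew" where
  "translate c f = pcompose f [:const c, 1:]"

lemma translate_0 [simp]: "translate c 0 = 0"
  and translate_1 [simp]: "translate c 1 = 1"
  and translate_add: "translate c (f + g) = translate c f + translate c g"
  and translate_smult: "translate c (smult a f) = smult a (translate c f)"
  and translate_pCons: "translate c (pCons a f) =
        [:a:] + smult (const c) (translate c f) + pCons 0 (translate c f)"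
  by (simp_all add: translate_def pcompose_add pcompose_smult pcompose_pCons pcompose_1)

text \<open>Compatibility with the action of \<open>y\<close>, which becomes that of
  \<open>y + c\<close>. Multiplicativity of \<open>translate\<close> follows from it by
  induction.\<close>

lemma translate_ymult:
  "translate c (ymult f) = ymult (translate c f) + smult (const c) (translate c f)"
proof (induction f)
  case (pCons a f)
  have *: "ymult (pCons b h) = pCons (der b) (ymult h) + [:0, b:]" for b h
    by (rule poly_eqI) (auto simp: coeff_ymult coeff_pCons split: nat.split)
  have **: "ymult [:b:] = [:der b, b:]" for b
    by (rule poly_eqI) (auto simp: coeff_ymult coeff_pCons split: nat.split)
  show ?case
    by (simp add: * ** translate_pCons translate_add pCons.IH ymult_add ymult_smult smult_add_right)
qed simp

lemma translate_skew_mult: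
  "translate c (skew_mult f v) = skew_mult (translate c f) (translate c v)"
proof (induction f arbitrary: v)
  case (pCons a f)
  have "skew_mult (pCons 0 h) w = skew_mult h (ymult w)" for h w
    by (simp add: skew_mult_pCons)
  moreover have "skew_mult h (smult (const c) w) = smult (const c) (skew_mult h w)" for h w
    using skew_mult_assoc[of h "[:const c:]" w]
    by (simp add: skew_mult_const_right skew_mult_smult_left)
  ultimately show ?case
    by (simp add: skew_mult_pCons translate_add translate_smult translate_pCons pCons.IH
        translate_ymult skew_mult_add_left skew_mult_smult_left skew_mult_add_right)
qed simp

lemma translate_translate: "translate c (translate d f) = translate (c + d) f"
proof (induction f)
  case (pCons a f)
  have 1: "translate c [:b:] = [:b:]" for b
    by (simp add: translate_def)
  have 2: "translate c (pCons 0 h) = smult (const c) (translate c h) + pCons 0 (translate c h)" for h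
    by (simp add: translate_pCons)
  show ?case
    by (simp add: translate_pCons translate_add translate_smult 1 2 pCons.IH const_add smult_add_left)
qed simp

lemma translate_zero_shift [simp]: "translate 0 f = f"
  by (simp add: translate_def pcompose_idR)

lemma translate_carrier: "f \<in> skew_carrier \<Longrightarrow> translate c f \<in> skew_carrier"
  by (induction f) (auto simp: translate_pCons intro!: skew_carrier_add skew_carrier_smult)

lemma translate_ring_iso: "translate c \<in> ring_iso skew_ring skew_ring"
proof (rule ring_iso_memI)
  show "bij_betw (translate c) (carrier skew_ring) (carrier skew_ring)"
    by (rule bij_betw_byWitness[of _ "translate (- c)"])
       (auto simp: translate_translate translate_carrier)
qed (simp_all add: translate_carrier translate_skew_mult translate_add)

end

section \<open>The radical of the skew polynomial ring\<close>

lemma lookup_single_zero_mult: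
  fixes a :: "'k::field coef"
  shows "Poly_Mapping.lookup (Poly_Mapping.single 0 q * a) c = q * Poly_Mapping.lookup a c"
  by (induction a rule: poly_mapping_induct_single)
     (simp_all add: mult_single lookup_single lookup_add distrib_left when_def)

text \<open>The value at \<open>g = 1\<close> of the \<open>j\<close>-th iterate of \<open>g d/dg\<close>; for \<open>j = 0\<close> this is the augmentation \<open>\<epsilon>\<close>.\<close>

definition moment :: "nat \<Rightarrow> 'k coef \<Rightarrow> 'k::field poly" where
  "moment j a = (\<Sum>c\<in>Poly_Mapping.keys a. smult (c ^ j) (Poly_Mapping.lookup a c))"

lemma moment_0 [simp]: "moment j 0 = 0"
  by (simp add: moment_def)

lemma moment_add: "moment j (a + b) = moment j a + moment j b"
  unfolding moment_def by (rule setsum_keys_plus_distrib) (simp_all add: smult_add_right)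

lemma moment_uminus: "moment j (- a) = - moment j a"
  using moment_add[of j a "- a"] by (simp add: eq_neg_iff_add_eq_0 add.commute)

lemma moment_single: "moment j (Poly_Mapping.single c q) = smult (c ^ j) q"
  by (simp add: moment_def)

lemma moment_charge: "moment j (charge a) = moment (Suc j) a"
  by (induction a rule: poly_mapping_induct_single)
     (simp_all add: charge_add moment_add moment_single mult.commute)

lemma moment_xderiv: "moment j (xderiv a) = pderiv (moment j a)"
  by (induction a rule: poly_mapping_induct_single)
     (simp_all add: xderiv_add moment_add moment_single pderiv_add pderiv_smult)

lemma of_nat_mult_poly: "of_nat n * (q :: 'a::comm_semiring_1 poly) = smult (of_nat n) q"
  by (simp add: of_nat_poly)

text \<open>The Leibniz rule for iterates of \<open>g d/dg\<close>; on group elements it is the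
  binomial expansion of \<open>(c + d)^j\<close>.\<close>

lemma moment_mult:
  "moment j (a * b) = (\<Sum>i\<le>j. of_nat (j choose i) * (moment i a * moment (j - i) b))"
proof (induction a rule: poly_mapping_induct_single)
  case (single c q)
  show ?case
  proof (induction b rule: poly_mapping_induct_single)
    case (single d r)
    show ?case
      by (simp add: mult_single moment_single binomial_ring smult_sum of_nat_mult_poly)
         (simp add: mult_ac)
  qed (simp_all add: distrib_left moment_add sum.distrib)
qed (simp_all add: distrib_left distrib_right moment_add sum.distrib)

lemma moment_var_x_mult: "moment j (var_x * a) = [:0, 1:] * moment j a"
  by (induction a rule: poly_mapping_induct_single)
     (simp_all add: moment_add moment_single var_x_def mult_single distrib_left)

text \<open>Lagrange interpolation: a combination of the moments isolates the value at a single key.\<close>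

lemma moments_vanish_imp_zero:
  assumes "\<And>j. moment j a = 0"
  shows "a = 0"
proof (rule ccontr)
  assume "a \<noteq> 0"
  then obtain c where c: "c \<in> Poly_Mapping.keys a"
    by (metis in_keys_iff lookup_zero poly_mapping_eqI)
  define f where "f = (\<Prod>d\<in>Poly_Mapping.keys a - {c}. [:- d, 1:])"
  have root: "poly f d = 0 \<longleftrightarrow> d \<noteq> c" if "d \<in> Poly_Mapping.keys a" for d
    using that by (auto simp: f_def poly_prod)
  have "0 = (\<Sum>j\<le>degree f. smult (coeff f j) (moment j a))"
    by (simp add: assms)
  also have "\<dots> = (\<Sum>d\<in>Poly_Mapping.keys a. smult (poly f d) (Poly_Mapping.lookup a d))"
    unfolding moment_def smult_sum_right poly_altdef smult_sum
    by (subst sum.swap) simp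
  also have "\<dots> = (\<Sum>d\<in>Poly_Mapping.keys a. if d = c then smult (poly f c) (Poly_Mapping.lookup a c) else 0)"
    by (rule sum.cong) (use root in auto)
  also have "\<dots> = smult (poly f c) (Poly_Mapping.lookup a c)"
    using c by simp
  finally show False
    using c root[OF c] by (simp add: in_keys_iff)
qed

lemma char_coef: "CHAR('k::field coef) = CHAR('k)"
proof (rule CHAR_eqI)
  have "of_nat n = (0 :: 'k coef) \<longleftrightarrow> of_nat n = (0 :: 'k poly)" for n
  proof -
    have "(of_nat n :: 'k coef) = Poly_Mapping.single 0 (of_nat n)"
      by (simp only: single_of_nat)
    moreover have "Poly_Mapping.single (0 :: 'k) q = 0 \<longleftrightarrow> q = 0" for q :: "'k poly"
      by (metis lookup_single_eq lookup_zero single_zero)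
    ultimately show ?thesis
      by (simp only:)
  qed
  then have *: "of_nat n = (0 :: 'k coef) \<longleftrightarrow> CHAR('k) dvd n" for n
    by (simp add: of_nat_eq_0_iff_char_dvd)
  show "of_nat CHAR('k) = (0 :: 'k coef)"
    by (simp only: *) simp
  show "CHAR('k) dvd n" if "of_nat n = (0 :: 'k coef)" for n
    using that by (simp only: *)
qed

lemma single_power: "Poly_Mapping.single c q ^ n = Poly_Mapping.single (of_nat n * c) (q ^ n)"
  for q :: "'k::field poly"
  by (induction n) (simp_all add: mult_single distrib_right)

text \<open>The p-th power is additive in characteristic \<open>p\<close> and sends
  \<open>q g^c\<close> to \<open>q^p\<close>, since \<open>p c = 0\<close> in \<open>k\<close>. Only
  the augmentation survives.\<close>

lemma coef_frobenius:
  fixes a :: "'k::field coef"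
  assumes "prime (CHAR('k))"
  shows "a ^ CHAR('k) = Poly_Mapping.single 0 (moment 0 a ^ CHAR('k))"
proof (induction a rule: poly_mapping_induct_single)
  case zero
  then show ?case
    using assms by (simp add: zero_power prime_gt_0_nat)
next
  case (single c q)
  then show ?case
    by (simp add: single_power moment_single)
next
  case (add a b)
  have "(a + b) ^ CHAR('k) = a ^ CHAR('k) + b ^ CHAR('k)"
    by (rule freshmans_dream) (use assms in \<open>simp_all add: char_coef\<close>)
  moreover have "(moment 0 a + moment 0 b) ^ CHAR('k) = moment 0 a ^ CHAR('k) + moment 0 b ^ CHAR('k)"
    by (rule freshmans_dream) (use assms in simp_all)
  ultimately show ?case
    by (simp add: add moment_add single_add)
qed

section \<open>From a nonzero radical element to a contradiction\<close>

context skew_poly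
begin

interpretation skew: ring skew_ring
  by (rule skew_ring_ring)

text \<open>A recursion: among the moments of \<open>a\<close> on the right, the one of order
  \<open>j + 1\<close> occurs only with the factor \<open>x\<close>, and all others have order at
  most \<open>j\<close>.\<close>

lemma moment_der:
  "moment j (der a) = - ([:0, 1:] * moment (Suc j) a
     + (\<Sum>i\<le>j. of_nat (j choose i) * (moment i L * pderiv (moment (j - i) a))))"
  unfolding der_def moment_uminus moment_add moment_var_x_mult moment_charge
    moment_mult[of j L] moment_xderiv ..

text \<open>If the augmentation vanished on \<open>I\<close>, the recursion would make every moment
  vanish there, one order at a time: the factor \<open>x\<close> cancels in \<open>k[x]\<close>.
  Then \<open>I\<close> would contain no nonzero element.\<close>

lemma der_stable_moment_nonzero:
  assumes der: "\<And>b. b \<in> I \<Longrightarrow> der b \<in> I" and a: "a \<in> I" "a \<noteq> 0"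
  shows "\<exists>b\<in>I. moment 0 b \<noteq> 0"
proof (rule ccontr)
  assume no: "\<not> ?thesis"
  have "\<forall>b\<in>I. moment j b = 0" for j
  proof (induction j rule: less_induct)
    case (less j)
    show ?case
    proof (cases j)
      case 0
      then show ?thesis using no by simp
    next
      case (Suc m)
      have "moment (Suc m) b = 0" if b: "b \<in> I" for b
      proof -
        have "moment m (der b) = 0"
          using less der b Suc by simp
        moreover have "moment (m - i) b = 0" for i
          using less b Suc by simp
        ultimately have "[:0, 1:] * moment (Suc m) b = 0"
          unfolding moment_der by (simp del: mult_pCons_left)
        then show ?thesis
          by simp
      qed
      then show ?thesis
        using Suc by simp
    qed
  qed
  then show False
    using a moments_vanish_imp_zero by blast
qed

lemma degree_translate_le: "degree (translate c f) \<le> degree f"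
proof (induction f)
  case (pCons a f)
  show ?case
  proof (cases "f = 0")
    case True
    then show ?thesis by (simp add: translate_def)
  next
    case False
    have "degree (smult (const c) (translate c f)) \<le> Suc (degree f)"
      using degree_smult_le[of "const c" "translate c f"] pCons.IH by linarith
    moreover have "degree (pCons 0 (translate c f)) \<le> Suc (degree f)"
      using degree_pCons_le[of 0 "translate c f"] pCons.IH by linarith
    ultimately show ?thesis
      using False by (auto simp: translate_pCons intro!: degree_add_le)
  qed
qed simp

text \<open>Since \<open>y + c\<close> is monic in \<open>y\<close>, the leading terms cancel. The
  first alternative takes care of constants, whose degree cannot drop.\<close>

lemma degree_translate_diff:
  "translate c f = f \<or> degree (translate c f - f) < degree f"
proof (induction f)
  case (pCons a f)
  show ?case
  proof (cases "f = 0")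
    case True
    then show ?thesis by (simp add: translate_def)
  next
    case False
    have eq: "translate c (pCons a f) - pCons a f
        = smult (const c) (translate c f) + pCons 0 (translate c f - f)"
      by (simp add: translate_pCons)
    have "degree (smult (const c) (translate c f)) \<le> degree f"
      using degree_smult_le[of "const c" "translate c f"] degree_translate_le[of c f] by linarith
    moreover have "degree (pCons 0 (translate c f - f)) \<le> degree f"
      using pCons.IH degree_pCons_le[of 0 "translate c f - f"] by auto
    ultimately have "degree (translate c (pCons a f) - pCons a f) \<le> degree f"
      unfolding eq by (rule degree_add_le)
    then show ?thesis
      using False by simp
  qed
qed simp

text \<open>Multiplication by \<open>const c\<close> scales every scalar entry by \<open>c\<close>.
  Fixing a group element and a power of \<open>x\<close> therefore reduces evaluation to ordinary
  polynomials over \<open>k\<close>.\<close>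

lemma lookup_poly_const:
  "coeff (Poly_Mapping.lookup (poly f (const c)) e) m
     = poly (map_poly (\<lambda>a. coeff (Poly_Mapping.lookup a e) m) f) c"
  by (induction f)
     (simp_all add: map_poly_pCons lookup_add const_def lookup_single_zero_mult)

text \<open>Invariance makes \<open>f\<close> take the same value at every \<open>const c\<close>,
  so each scalar component of \<open>f - f(0)\<close> has infinitely many roots. Over the prime
  field this fails: \<open>y^p - y\<close> is invariant under all its translations.\<close>

lemma translation_invariant_degree:
  assumes inf: "infinite (UNIV :: 'k set)" and inv: "\<And>c. translate c f = f"
  shows "degree f = 0"
proof -
  define h where "h = f - [:coeff f 0:]"
  have "poly h (const c) = 0" for c
  proof -
    have "poly f (const c) = poly (translate c f) 0"
      by (simp add: translate_def poly_pcompose)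
    then show ?thesis
      by (simp add: inv h_def poly_0_coeff_0)
  qed
  then have "map_poly (\<lambda>a. coeff (Poly_Mapping.lookup a e) m) h = 0" for e m
    using poly_roots_finite[of "map_poly (\<lambda>a. coeff (Poly_Mapping.lookup a e) m) h"] inf
    by (auto simp flip: lookup_poly_const)
  then have "coeff (Poly_Mapping.lookup (coeff h n) e) m = 0" for n e m
    by (metis (no_types, lifting) coeff_0 coeff_map_poly lookup_zero)
  then have "h = 0"
    by (intro poly_eqI poly_mapping_eqI) simp
  then have "f = [:coeff f 0:]"
    by (simp add: h_def)
  then show ?thesis
    by (metis degree_pCons_0)
qed

lemma jacobson_radical_const:
  assumes inf: "infinite (UNIV :: 'k set)"
    and f: "f \<in> jacobson_radical skew_ring" "f \<noteq> 0"
  shows "\<exists>a. a \<noteq> 0 \<and> [:a:] \<in> jacobson_radical skew_ring"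
proof -
  let ?J = "jacobson_radical skew_ring"
  have "\<exists>h. (h \<in> ?J \<and> h \<noteq> 0) \<and> (\<forall>g. g \<in> ?J \<and> g \<noteq> 0 \<longrightarrow> degree h \<le> degree g)"
    by (rule ex_has_least_nat[of _ f]) (use f in simp)
  then obtain h where h: "h \<in> ?J" "h \<noteq> 0"
    and min: "\<And>g. g \<in> ?J \<Longrightarrow> g \<noteq> 0 \<Longrightarrow> degree h \<le> degree g"
    by blast
  have hc: "h \<in> skew_carrier"
    using h skew.jacobson_radical_subset by auto
  have "translate c h = h" for c
  proof (rule ccontr)
    assume neq: "translate c h \<noteq> h"
    have "translate c h \<in> ?J"
      using h(1) by (rule jacobson_radical_ring_iso[OF skew_ring_ring skew_ring_ring translate_ring_iso])
    then have "translate c h - h \<in> ?J"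
      using skew.left_ideal_minus[OF skew.jacobson_radical_left_ideal, of "translate c h" h] h hc
      by simp
    with min[of "translate c h - h"] neq degree_translate_diff[of c h] show False
      by simp
  qed
  then have "degree h = 0"
    by (rule translation_invariant_degree[OF inf])
  then obtain a where "h = [:a:]"
    by (rule degree_eq_zeroE)
  then show ?thesis
    using h by auto
qed

theorem jacobson_radical_skew_ring:
  assumes inf: "infinite (UNIV :: 'k set)" and char: "prime (CHAR('k))"
  shows "jacobson_radical skew_ring = {0}"
proof -
  let ?J = "jacobson_radical skew_ring"
  let ?p = "CHAR('k)"
  note J = skew.jacobson_radical_left_ideal
  have False if f: "f \<in> ?J" "f \<noteq> 0" for f
  proof -
    obtain a where a: "a \<noteq> 0" "[:a:] \<in> ?J"
      using jacobson_radical_const[OF inf f] by blast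
    define I where "I = {b. [:b:] \<in> ?J}"
    have coef: "b \<in> coef_ring" if "b \<in> I" for b
      using that skew.jacobson_radical_subset by (auto simp: I_def)
    have ideal: "c * b \<in> I" if "c \<in> coef_ring" "b \<in> I" for b c
      using left_ideal_mult[OF J, of "[:c:]" "[:b:]"] that by (simp add: I_def)
    \<comment> \<open>\<delta>(b) is the commutator of \<open>y\<close> and \<open>b\<close>; the
      radical contains both products because it is two-sided.\<close>
    have "der b \<in> I" if b: "b \<in> I" for b
    proof -
      have "skew_mult [:0, 1:] [:b:] \<in> ?J"
        using left_ideal_mult[OF J, of "[:0, 1:]" "[:b:]"] b by (simp add: I_def)
      moreover have "skew_mult [:b:] [:0, 1:] \<in> ?J"
        using skew.jacobson_radical_mult_right[of "[:b:]" "[:0, 1:]"] b by (simp add: I_def)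
      ultimately have "skew_mult [:0, 1:] [:b:] - skew_mult [:b:] [:0, 1:] \<in> ?J"
        using skew.left_ideal_minus[OF J, of "skew_mult [:0, 1:] [:b:]" "skew_mult [:b:] [:0, 1:]"]
          coef[OF b] by (simp add: skew_carrier_mult)
      moreover have "skew_mult [:0, 1:] [:b:] - skew_mult [:b:] [:0, 1:] = [:der b:]"
        by (simp add: skew_mult_y_left ymult_def map_poly_pCons)
      ultimately show ?thesis
        by (simp add: I_def)
    qed
    then obtain b where b: "b \<in> I" "moment 0 b \<noteq> 0"
      using der_stable_moment_nonzero[of I a] a by (auto simp: I_def)
    define r where "r = [:0, 1:] * moment 0 b"
    define z :: "'k coef" where "z = Poly_Mapping.single 0 (r ^ ?p)"
    have deg: "degree r > 0"
      using b(2) by (simp add: r_def)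
    have p: "?p > 0"
      using char by (rule prime_gt_0_nat)
    \<comment> \<open>By Frobenius \<open>z\<close> is \<open>x^p b^p\<close>. Splitting off one
      factor \<open>b\<close> shows that it belongs to \<open>I\<close>.\<close>
    have "z = Poly_Mapping.single 0 ([:0, 1:] ^ ?p) * b ^ ?p"
      by (simp add: z_def r_def coef_frobenius[OF char] mult_single power_mult_distrib del: mult_pCons_left)
    also have "b ^ ?p = b ^ (?p - 1) * b"
      using p by (metis power_minus_mult)
    finally have zI: "z \<in> I"
    proof -
      have "b ^ n \<in> coef_ring" for n
        by (induction n) (simp_all add: coef_ring_mult coef[OF b(1)])
      then show "z = Poly_Mapping.single 0 ([:0, 1:] ^ ?p) * (b ^ (?p - 1) * b) \<Longrightarrow> z \<in> I"
        using ideal[of "Poly_Mapping.single 0 ([:0, 1:] ^ ?p) * b ^ (?p - 1)" b] b(1)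
        by (simp add: coef_ring_mult mult.assoc)
    qed
    \<comment> \<open>\<open>z\<close> involves only the identity of the group, so its charge is
      zero, and a p-th power has zero derivative in \<open>x\<close>.\<close>
    have "der (1 - z) = 0"
    proof -
      have "pderiv (r ^ ?p) = 0"
        by (simp add: pderiv_power of_nat_poly)
      then have "der z = 0"
        by (simp add: der_def z_def)
      then show ?thesis
        using der_add[of "1 - z" z] by simp
    qed
    obtain h where h: "skew_mult h (1 - [:z:]) = 1"
      using skew.jacobson_radical_left_inverse[of "[:z:]"] zI coef[OF zI] by (auto simp: I_def)
    have "1 - [:z:] = [:1 - z:]"
      by (simp add: one_pCons)
    with h have "smult (1 - z) h = 1"
      using skew_mult_const_right[OF \<open>der (1 - z) = 0\<close>] by simp
    \<comment> \<open>Comparing entries at \<open>y^0\<close> and at the group identity turns the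
      left inverse \<open>h\<close> into an inverse of \<open>1 - r^p\<close> in
      \<open>k[x]\<close>.\<close>
    then have "coeff (smult (1 - z) h) 0 = 1"
      by simp
    moreover have "1 - z = Poly_Mapping.single 0 (1 - r ^ ?p)"
      by (simp add: z_def single_diff)
    ultimately have "Poly_Mapping.lookup (Poly_Mapping.single 0 (1 - r ^ ?p) * coeff h 0) 0 = 1"
      by simp
    then have "(1 - r ^ ?p) * Poly_Mapping.lookup (coeff h 0) 0 = 1"
      by (simp add: lookup_single_zero_mult)
    then have "is_unit (1 - r ^ ?p)"
      by (metis dvd_triv_left)
    then have "degree (1 - r ^ ?p) = 0"
      by (metis is_unit_iff_degree not_is_unit_0)
    moreover have "degree (1 - r ^ ?p) = ?p * degree r"
    proof -
      have "degree (r ^ ?p) = ?p * degree r"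
        using deg by (intro degree_power_eq) auto
      then show ?thesis
        using deg p degree_add_eq_right[of 1 "- (r ^ ?p)"] by simp
    qed
    ultimately show False
      using deg p by simp
  qed
  then show ?thesis
    using skew.left_ideal_zero[OF J] by auto
qed

end

section \<open>The isomorphism with \<open>H\<^sub>\<lambda>\<close>\<close>

lemma mult_poly_lin: "b * poly_lin F f = poly_lin (\<lambda>i a. b * F i a) f"
  for b :: "'b::ring_1"
  by (simp add: poly_lin_def sum_distrib_left)

lemma single_Word_Cons: "Poly_Mapping.single (Word (i # ws)) c = gen i * Poly_Mapping.single (Word ws) c"
  by (simp add: gen_def mult_single plus_word_def)

text \<open>Letters are peeled off on the left, the side from which the operators below act.\<close>

lemma free_algebra_induct_gen [case_names scalar gen add]:
  fixes f :: "('i, 'k::comm_ring_1) free_algebra"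
  assumes "\<And>c. P (scalar c)" and gen: "\<And>i f. P f \<Longrightarrow> P (gen i * f)"
    and "\<And>f g. P f \<Longrightarrow> P g \<Longrightarrow> P (f + g)"
  shows "P f"
proof (induction f rule: free_algebra_induct)
  case (single w c)
  have "P (Poly_Mapping.single (Word ws) c)" for ws
  proof (induction ws)
    case Nil
    then show ?case
      using assms(1)[of c] by (simp add: scalar_def zero_word_def)
  qed (simp add: single_Word_Cons gen)
  from this[of "letters w"] show ?case
    by simp
qed (rule assms(3))

definition unipotent :: "'k \<Rightarrow> 'k::field^2^2" where
  "unipotent c = vector [vector [1, c], vector [0, 1]]"

lemma unipotent_entry [simp]: "unipotent c $ 1 $ 2 = c"
  by (simp add: unipotent_def)

lemma unipotent_inject [simp]: "unipotent c = unipotent d \<longleftrightarrow> c = d"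
  by (metis unipotent_entry)

lemma linear_act_unipotent_x [simp]: "linear_act (unipotent c) gen_x = gen_x"
  and linear_act_unipotent_y: "linear_act (unipotent c) gen_y = gen_y + scalar c * gen_x"
  by (simp_all add: linear_act_def unipotent_def sum_2)

lemma linear_act_scalar [simp]: "linear_act A (scalar c) = scalar c"
  and linear_act_add: "linear_act A (f + g) = linear_act A f + linear_act A g"
  and linear_act_mult: "linear_act A (f * g) = linear_act A f * linear_act A g"
  and linear_act_sum: "linear_act A (sum h B) = (\<Sum>b\<in>B. linear_act A (h b))"
  by (simp_all add: linear_act_def subst_gens_add subst_gens_mult subst_gens_sum)

lemma linear_act_zero [simp]: "linear_act A 0 = 0"
  and linear_act_one [simp]: "linear_act A 1 = 1"
  using linear_act_scalar[of A 0] linear_act_scalar[of A 1] by simp_all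

lemma linear_act_power: "linear_act A (f ^ n) = linear_act A f ^ n"
  by (induction n) (simp_all add: linear_act_mult)

definition xpoly :: "'k poly \<Rightarrow> (2, 'k::field) free_algebra" where
  "xpoly = poly_lin (\<lambda>i c. scalar c * gen_x ^ i)"

lemma xpoly_0 [simp]: "xpoly 0 = 0"
  by (simp add: xpoly_def poly_lin_def)

lemma xpoly_add: "xpoly (q + r) = xpoly q + xpoly r"
  unfolding xpoly_def by (rule poly_lin_add) (simp_all add: scalar_add distrib_right)

lemma xpoly_smult: "xpoly (smult c q) = scalar c * xpoly q"
  by (simp add: xpoly_def poly_lin_smult mult_poly_lin scalar_mult mult.assoc)

lemma xpoly_var: "xpoly (pCons 0 q) = gen_x * xpoly q"
proof -
  have "scalar c * gen_x ^ Suc i = gen_x * (scalar c * gen_x ^ i)" for i and c :: 'a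
    by (simp add: scalar_commute[of c gen_x] flip: mult.assoc)
  then show ?thesis
    by (simp add: xpoly_def poly_lin_pCons mult_poly_lin)
qed

lemma xpoly_1: "xpoly 1 = 1"
  by (simp add: xpoly_def poly_lin_def)

lemma linear_act_xpoly: "linear_act (unipotent c) (xpoly q) = xpoly q"
  by (simp add: xpoly_def poly_lin_def linear_act_sum linear_act_mult linear_act_power)

lemma lookup_single_one_mult:
  fixes a :: "'k::field coef"
  shows "Poly_Mapping.lookup (Poly_Mapping.single d 1 * a) c = Poly_Mapping.lookup a (c - d)"
  by (induction a rule: poly_mapping_induct_single)
     (simp_all add: mult_single lookup_single lookup_add distrib_left when_def algebra_simps)

section \<open>The free algebra acting on skew polynomials\<close>

context skew_poly
begin

text \<open>Every element is a sum of terms \<open>q(x) g^c y^n\<close>, so the powers of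
  \<open>y\<close> generate everything under addition and left multiplication by scalars,
  \<open>x\<close> and group elements. No step multiplies by \<open>y\<close> on the left.\<close>

lemma skew_carrier_induct [consumes 1, case_names zero add const var_x group power]:
  assumes f: "f \<in> skew_carrier"
    and "P 0" and add: "\<And>f g. f \<in> skew_carrier \<Longrightarrow> g \<in> skew_carrier \<Longrightarrow> P f \<Longrightarrow> P g \<Longrightarrow> P (f + g)"
    and const: "\<And>c f. f \<in> skew_carrier \<Longrightarrow> P f \<Longrightarrow> P (smult (const c) f)"
    and var: "\<And>f. f \<in> skew_carrier \<Longrightarrow> P f \<Longrightarrow> P (smult var_x f)"
    and group: "\<And>c f. c \<in> prime_field \<Longrightarrow> f \<in> skew_carrier \<Longrightarrow> P f \<Longrightarrow> P (smult (Poly_Mapping.single c 1) f)"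
    and power: "\<And>n. P (monom 1 n)"
  shows "P f"
proof -
  have carrier: "monom a n \<in> skew_carrier" if "a \<in> coef_ring" for a n
    using that by (simp add: skew_carrier_def)
  have sum: "P (sum h B) \<and> sum h B \<in> skew_carrier"
    if "finite B" "\<And>b. b \<in> B \<Longrightarrow> h b \<in> skew_carrier \<and> P (h b)" for h and B :: "'b set"
    using that by (induction B) (auto simp: \<open>P 0\<close> intro!: add skew_carrier_add)
  have poly: "P (monom (Poly_Mapping.single 0 q) n)" for q n
  proof (induction q)
    case 0
    then show ?case by (simp add: \<open>P 0\<close>)
  next
    case (pCons c q)
    have "monom (Poly_Mapping.single 0 (pCons c q)) n
        = smult (const c) (monom 1 n) + smult var_x (monom (Poly_Mapping.single 0 q) n)"
      by (simp add: const_def var_x_def smult_monom mult_single add_monom flip: single_add)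
    then show ?case
      using carrier pCons.IH by (auto intro!: add const var power skew_carrier_smult)
  qed
  have single: "P (monom (Poly_Mapping.single c q) n)" if "c \<in> prime_field" for c q n
  proof -
    have "monom (Poly_Mapping.single c q) n
        = smult (Poly_Mapping.single c 1) (monom (Poly_Mapping.single 0 q) n)"
      by (simp add: smult_monom mult_single)
    then show ?thesis
      using group[OF that carrier poly] by simp
  qed
  have "P (monom a n)" if a: "a \<in> coef_ring" for a n
  proof -
    have "c \<in> prime_field" if "c \<in> Poly_Mapping.keys a" for c
      using a that by (auto simp: coef_ring_def)
    then have "P (\<Sum>c\<in>Poly_Mapping.keys a. monom (Poly_Mapping.single c (Poly_Mapping.lookup a c)) n)"
      using sum[of "Poly_Mapping.keys a" "\<lambda>c. monom (Poly_Mapping.single c (Poly_Mapping.lookup a c)) n"]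
        carrier single by simp
    then show ?thesis
      by (simp only: poly_mapping_sum_single[of a, symmetric] flip: monom_sum)
  qed
  then have "P (\<Sum>i\<le>degree f. monom (coeff f i) i)"
    using sum[of "{..degree f}" "\<lambda>i. monom (coeff f i) i"] carrier f by (simp add: skew_carrier_coeff)
  then show ?thesis
    by (simp add: poly_as_sum_of_monoms)
qed

fun word_op :: "2 list \<Rightarrow> 'k skew \<Rightarrow> 'k skew" where
  "word_op [] v = v"
| "word_op (i # ws) v = (if i = 1 then smult var_x (word_op ws v) else ymult (word_op ws v))"

text \<open>Left multiplication by the image of \<open>f\<close> in the skew polynomial ring,
  obtained from operators for the two letters. No relation has to be respected, since the algebra is
  free.\<close>

definition rep :: "(2, 'k) free_algebra \<Rightarrow> 'k skew \<Rightarrow> 'k skew" where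
  "rep f v = (\<Sum>w\<in>Poly_Mapping.keys f.
     smult (const (Poly_Mapping.lookup f w)) (word_op (letters w) v))"

lemma rep_add: "rep (f + g) v = rep f v + rep g v"
  unfolding rep_def by (rule setsum_keys_plus_distrib) (simp_all add: const_add smult_add_left)

lemma rep_single: "rep (Poly_Mapping.single w c) v = smult (const c) (word_op (letters w) v)"
  by (simp add: rep_def)

lemma rep_0 [simp]: "rep 0 v = 0"
  by (simp add: rep_def)

lemma rep_scalar [simp]: "rep (scalar c) v = smult (const c) v"
  by (simp add: scalar_def rep_single)

lemma rep_1 [simp]: "rep 1 v = v"
  using rep_scalar[of 1 v] by simp

lemma ymult_const: "ymult (smult (const c) v) = smult (const c) (ymult v)"
  by (simp add: ymult_smult)

lemma rep_gen_mult:
  "rep (gen i * f) v = (if i = 1 then smult var_x (rep f v) else ymult (rep f v))"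
proof (induction f rule: free_algebra_induct)
  case (add f g)
  then show ?case
    by (simp add: distrib_left rep_add smult_add_right ymult_add)
next
  case (single w c)
  then show ?case
    by (simp add: gen_def mult_single rep_single ymult_const mult.commute)
qed

lemma rep_scalar_mult: "rep (scalar c * f) v = smult (const c) (rep f v)"
proof (induction f rule: free_algebra_induct)
  case (add f g)
  then show ?case
    by (simp add: distrib_left rep_add smult_add_right)
next
  case (single w d)
  then show ?case
    by (simp add: scalar_def mult_single rep_single const_def mult.commute)
qed

lemma rep_x [simp]: "rep gen_x v = smult var_x v"
  and rep_y [simp]: "rep gen_y v = ymult v"
  using rep_gen_mult[of _ 1 v] by simp_all

lemma rep_mult: "rep (f * g) v = rep f (rep g v)"
proof (induction f rule: free_algebra_induct_gen)
  case (gen i f)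
  then show ?case
    by (simp add: rep_gen_mult mult.assoc)
qed (simp_all add: rep_scalar_mult rep_add distrib_right)

lemma rep_add_right: "rep f (u + v) = rep f u + rep f v"
  by (induction f rule: free_algebra_induct_gen)
     (simp_all add: rep_gen_mult rep_add smult_add_right ymult_add)

lemma rep_zero_right [simp]: "rep f 0 = 0"
  using rep_add_right[of f 0 0] by simp

lemma rep_sum_left: "rep (sum h B) v = (\<Sum>b\<in>B. rep (h b) v)"
  by (induction B rule: infinite_finite_induct) (simp_all add: rep_add)

lemma rep_sum_right: "rep f (sum h B) = (\<Sum>b\<in>B. rep f (h b))"
  by (induction B rule: infinite_finite_induct) (simp_all add: rep_add_right)

lemma skew_mult_rep: "skew_mult (rep f u) v = rep f (skew_mult u v)"
  by (induction f rule: free_algebra_induct_gen)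
     (simp_all add: rep_gen_mult rep_add skew_mult_add_left skew_mult_smult_left flip: ymult_skew_mult)

lemma rep_carrier: "v \<in> skew_carrier \<Longrightarrow> rep f v \<in> skew_carrier"
  by (induction f rule: free_algebra_induct_gen)
     (simp_all add: rep_gen_mult rep_add skew_carrier_add skew_carrier_smult skew_carrier_ymult)

abbreviation grp :: "'k \<Rightarrow> 'k coef" where
  "grp c \<equiv> Poly_Mapping.single c 1"

text \<open>The smash product relation as an identity of operators. For the letter \<open>y\<close>
  it says \<open>(y + c x) g^c = g^c y\<close>, which is the value of \<delta> on
  \<open>g^c\<close>.\<close>

lemma smult_grp_rep:
  "smult (grp c) (rep f v) = rep (linear_act (unipotent c) f) (smult (grp c) v)"
proof (induction f rule: free_algebra_induct_gen)
  case (scalar d)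
  then show ?case
    by (simp add: mult.commute)
next
  case (gen i f)
  show ?case
  proof (cases "i = 1")
    case True
    then show ?thesis
      by (simp add: rep_gen_mult linear_act_mult gen.IH[symmetric] mult.commute)
  next
    case False
    then have i: "i = 2"
      using exhaust_2 by blast
    have "rep (linear_act (unipotent c) (gen i * f)) (smult (grp c) v)
        = ymult (smult (grp c) (rep f v)) + smult (const c) (smult var_x (smult (grp c) (rep f v)))"
      by (simp add: i linear_act_mult linear_act_unipotent_y rep_mult rep_add rep_gen_mult gen.IH[symmetric])
    also have "\<dots> = smult (grp c) (ymult (rep f v))"
      by (simp add: ymult_smult der_group mult.assoc)
    finally show ?thesis
      using i by (simp add: rep_gen_mult)
  qed
qed (simp add: linear_act_add rep_add smult_add_right)

end

section \<open>The smash product in coordinates indexed by the prime field\<close>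

lemma transvection_power: "transvection [^]\<^bsub>SL2_prime_field\<^esub> (n::nat) = unipotent (of_nat n)"
  by (simp add: transvection_pow unipotent_def)

locale unipotent_smash =
  fixes lam :: "'k::field^2^2 \<Rightarrow> 'k"
  assumes char: "CHAR('k) > 0" and lam: "lam \<in> group_algebra_elems transvection_group"
begin

abbreviation G :: "('k^2^2) monoid" where "G \<equiv> transvection_group"

abbreviation S :: "('k^2^2 \<Rightarrow> (2, 'k) free_algebra) ring" where "S \<equiv> smash_algebra"

abbreviation P :: "'k set" where "P \<equiv> prime_field"

lemma carrier_G: "carrier G = unipotent ` prime_field"
proof -
  interpret SL: group "SL2_prime_field :: ('k^2^2) monoid"
    by (rule SL2_prime_field_group)
  have "SL.ord transvection \<noteq> 0"
    using char by (simp add: transvection_ord)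
  from SL.generate_pow_nat[OF transvection_in_SL2 this] show ?thesis
    by (auto simp: carrier_transvection_group transvection_power prime_field_def)
qed

lemma unipotent_in_G [simp]: "unipotent c \<in> carrier G \<longleftrightarrow> c \<in> P"
  by (auto simp: carrier_G)

lemma finite_prime_field [simp]: "finite P"
proof -
  have "finite (carrier G)"
    using char by (intro card_ge_0_finite) (simp add: card_transvection_group)
  then show ?thesis
    unfolding carrier_G by (rule finite_imageD) (simp add: inj_on_def)
qed

lemma prime_field_uminus: "c \<in> P \<Longrightarrow> - c \<in> P"
proof -
  assume "c \<in> P"
  then obtain n where n: "c = of_nat n"
    by (auto simp: prime_field_def)
  \<comment> \<open>In characteristic \<open>p\<close> the factor \<open>p - 1\<close> equals
    \<open>-1\<close>.\<close>
  have "- c = of_nat (n * (CHAR('k) - 1))"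
    using char by (simp add: n of_nat_diff algebra_simps)
  then show ?thesis
    by (metis of_nat_in_prime_field)
qed

lemma prime_field_diff: "c \<in> P \<Longrightarrow> d \<in> P \<Longrightarrow> c - d \<in> P"
  using prime_field_add[of c "- d"] prime_field_uminus[of d] by simp

lemma G_mult: "unipotent c \<otimes>\<^bsub>G\<^esub> unipotent d = unipotent (c + d)"
  by (simp add: transvection_group_def subgroup_generated_def SL2_prime_field_def unipotent_def
      vec_eq_iff forall_2 matrix_matrix_mult_def sum_2 add.commute)

lemma G_one: "\<one>\<^bsub>G\<^esub> = unipotent 0"
  by (simp add: transvection_group_def subgroup_generated_def SL2_prime_field_def unipotent_def
      vec_eq_iff forall_2 mat_def)

lemma G_inv: "c \<in> P \<Longrightarrow> inv\<^bsub>G\<^esub> (unipotent c) = unipotent (- c)"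
  using group.inv_equality[OF transvection_group_group, of "unipotent (- c)" "unipotent c"]
  by (simp add: G_mult G_one prime_field_uminus)

lemma S_simps [simp]:
  "carrier S = {u. \<forall>h. h \<notin> carrier G \<longrightarrow> u h = 0}"
  "\<zero>\<^bsub>S\<^esub> = (\<lambda>h. 0)" "u \<oplus>\<^bsub>S\<^esub> v = (\<lambda>h. u h + v h)"
  by (simp_all add: smash_algebra_def smash_product_def)

lemma S_one: "\<one>\<^bsub>S\<^esub> = (\<lambda>h. if h = unipotent 0 then 1 else 0)"
  by (simp add: smash_algebra_def smash_product_def G_one)

lemma S_mult:
  assumes "c \<in> P"
  shows "(u \<otimes>\<^bsub>S\<^esub> v) (unipotent c)
    = (\<Sum>d\<in>P. u (unipotent d) * linear_act (unipotent d) (v (unipotent (c - d))))"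
proof -
  have inj: "inj_on unipotent P"
    by (simp add: inj_on_def)
  show ?thesis
    using assms
    by (auto simp: smash_algebra_def smash_product_def carrier_G[THEN equalityD1] 
        carrier_G sum.reindex[OF inj] G_inv G_mult intro!: sum.cong)
qed

lemma S_ring: "ring S"
  using char by (rule smash_algebra_ring)

sublocale S: ring S
  by (rule S_ring)

lemma S_ext:
  assumes "u \<in> carrier S" "v \<in> carrier S" "\<And>c. c \<in> P \<Longrightarrow> u (unipotent c) = v (unipotent c)"
  shows "u = v"
proof
  fix h show "u h = v h"
    using assms by (cases "h \<in> carrier G") (auto simp: carrier_G)
qed

lemma S_minus: "u \<in> carrier S \<Longrightarrow> v \<in> carrier S \<Longrightarrow> u \<ominus>\<^bsub>S\<^esub> v = (\<lambda>h. u h - v h)"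
proof -
  assume u: "u \<in> carrier S" and v: "v \<in> carrier S"
  have "\<ominus>\<^bsub>S\<^esub> v = (\<lambda>h. - v h)"
    by (rule S.minus_equality) (use v in auto)
  then show ?thesis
    by (simp add: a_minus_def)
qed

abbreviation emb :: "(2, 'k) free_algebra \<Rightarrow> 'k^2^2 \<Rightarrow> (2, 'k) free_algebra" where
  "emb \<equiv> smash_of_alg G"

lemma emb_carrier: "emb a \<in> carrier S"
  by (auto simp: smash_of_alg_def G_one)

lemma smash_of_group_carrier: "c \<in> P \<Longrightarrow> smash_of_group (unipotent c) \<in> carrier S"
  by (auto simp: smash_of_group_def)

lemma emb_mult: "c \<in> P \<Longrightarrow> (emb a \<otimes>\<^bsub>S\<^esub> v) (unipotent c) = a * v (unipotent c)"
proof -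
  assume c: "c \<in> P"
  have "(emb a \<otimes>\<^bsub>S\<^esub> v) (unipotent c)
      = (\<Sum>d\<in>P. if d = 0 then a * linear_act (unipotent 0) (v (unipotent c)) else 0)"
    unfolding S_mult[OF c] by (rule sum.cong) (auto simp: smash_of_alg_def G_one)
  moreover have "unipotent 0 = (mat 1 :: 'k^2^2)"
    by (simp add: unipotent_def vec_eq_iff forall_2 mat_def)
  ultimately show ?thesis
    by (simp add: linear_act_1)
qed

lemma smash_of_group_mult:
  assumes c: "c \<in> P" and d: "d \<in> P"
  shows "(smash_of_group (unipotent d) \<otimes>\<^bsub>S\<^esub> v) (unipotent c)
    = linear_act (unipotent d) (v (unipotent (c - d)))"
proof -
  have "(smash_of_group (unipotent d) \<otimes>\<^bsub>S\<^esub> v) (unipotent c)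
      = (\<Sum>e\<in>P. if e = d then linear_act (unipotent d) (v (unipotent (c - d))) else 0)"
    unfolding S_mult[OF c] by (rule sum.cong) (auto simp: smash_of_group_def)
  then show ?thesis
    using d by simp
qed

section \<open>The homomorphism onto the skew polynomial ring\<close>

definition L :: "'k coef" where
  "L = (\<Sum>c\<in>P. Poly_Mapping.single c [:lam (unipotent c):])"

sublocale skew_poly L
  by unfold_locales (simp add: L_def coef_ring_sum)

definition Psi :: "('k^2^2 \<Rightarrow> (2, 'k) free_algebra) \<Rightarrow> 'k skew" where
  "Psi u = (\<Sum>c\<in>P. rep (u (unipotent c)) (smult (grp c) 1))"

lemma grp_mult: "grp c * grp d = grp (c + d)"
  by (simp add: mult_single)

lemma Psi_add: "Psi (\<lambda>h. u h + v h) = Psi u + Psi v"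
  by (simp add: Psi_def rep_add sum.distrib)

text \<open>Operators from the left commute with right multiplication, so \<open>Psi v\<close> can
  be moved inside. Carrying \<open>g^d\<close> past the algebra coefficients of \<open>v\<close>
  twists them by the action; substituting \<open>c = d + e\<close> gives the smash product.\<close>

lemma Psi_mult: "Psi (u \<otimes>\<^bsub>S\<^esub> v) = skew_mult (Psi u) (Psi v)"
proof -
  let ?T = "\<lambda>d e. rep (u (unipotent d)) (rep (linear_act (unipotent d) (v (unipotent e))) (smult (grp (d + e)) 1))"
  have "skew_mult (sum h B) w = (\<Sum>b\<in>B. skew_mult (h b) w)" for h and B :: "'k set" and w
    by (induction B rule: infinite_finite_induct) (simp_all add: skew_mult_add_left)
  then have "skew_mult (Psi u) (Psi v) = (\<Sum>d\<in>P. rep (u (unipotent d)) (smult (grp d) (Psi v)))"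
    by (simp add: Psi_def[of u] skew_mult_rep skew_mult_smult_left)
  also have "\<dots> = (\<Sum>d\<in>P. \<Sum>e\<in>P. ?T d e)"
    by (simp add: Psi_def smult_sum_right smult_grp_rep grp_mult rep_sum_right)
  also have "\<dots> = (\<Sum>d\<in>P. \<Sum>c\<in>P. ?T d (c - d))"
  proof (rule sum.cong[OF refl])
    fix d assume "d \<in> P"
    then show "(\<Sum>e\<in>P. ?T d e) = (\<Sum>c\<in>P. ?T d (c - d))"
      by (intro sum.reindex_bij_witness[of _ "\<lambda>c. c - d" "\<lambda>e. e + d"])
         (auto simp: prime_field_diff prime_field_add add.commute)
  qed
  also have "\<dots> = (\<Sum>c\<in>P. \<Sum>d\<in>P. ?T d (c - d))"
    by (rule sum.swap)
  also have "\<dots> = Psi (u \<otimes>\<^bsub>S\<^esub> v)"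
    unfolding Psi_def by (rule sum.cong) (simp_all add: S_mult rep_sum_left rep_mult)
  finally show ?thesis by simp
qed

lemma Psi_carrier: "Psi u \<in> skew_carrier"
  unfolding Psi_def by (intro skew_carrier_sum rep_carrier skew_carrier_smult) simp_all

lemma Psi_smash_of_group: "c \<in> P \<Longrightarrow> Psi (smash_of_group (unipotent c)) = smult (grp c) 1"
proof -
  assume c: "c \<in> P"
  have "Psi (smash_of_group (unipotent c)) = (\<Sum>d\<in>P. if d = c then smult (grp c) 1 else 0)"
    unfolding Psi_def by (rule sum.cong) (auto simp: smash_of_group_def)
  with c show ?thesis by simp
qed

lemma Psi_one: "Psi \<one>\<^bsub>S\<^esub> = 1"
  using Psi_smash_of_group[of 0] by (simp add: S_one smash_of_group_def)

lemma Psi_emb: "Psi (emb a) = rep a 1"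
proof -
  have "Psi (emb a) = (\<Sum>d\<in>P. if d = 0 then rep a 1 else 0)"
    unfolding Psi_def by (rule sum.cong) (auto simp: smash_of_alg_def G_one pCons_one)
  then show ?thesis by simp
qed

lemma Psi_emb_mult: "Psi (emb a \<otimes>\<^bsub>S\<^esub> u) = rep a (Psi u)"
  by (simp add: Psi_mult Psi_emb skew_mult_rep)

lemma Psi_group_mult: "c \<in> P \<Longrightarrow> Psi (smash_of_group (unipotent c) \<otimes>\<^bsub>S\<^esub> u) = smult (grp c) (Psi u)"
  by (simp add: Psi_mult Psi_smash_of_group skew_mult_smult_left)

lemma Psi_ring_hom: "ring_hom_ring S skew_ring Psi"
  by (rule ring_hom_ringI)
     (simp_all add: S_ring skew_ring_ring Psi_carrier Psi_mult Psi_one del: S_simps(1),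
      simp add: Psi_add)

lemma rep_in_Psi_image: "f \<in> Psi ` carrier S \<Longrightarrow> rep a f \<in> Psi ` carrier S"
  using S.m_closed[OF emb_carrier] by (auto simp flip: Psi_emb_mult simp del: S_simps(1))

lemma group_in_Psi_image:
  "c \<in> P \<Longrightarrow> f \<in> Psi ` carrier S \<Longrightarrow> smult (grp c) f \<in> Psi ` carrier S"
  using S.m_closed[OF smash_of_group_carrier]
  by (auto simp flip: Psi_group_mult simp del: S_simps(1))

text \<open>The image contains all \<open>y^n\<close> and is closed under the operations of
  \<open>skew_carrier_induct\<close>, each being left multiplication by an image.\<close>

lemma Psi_surj: "Psi ` carrier S = carrier skew_ring"
proof
  show "Psi ` carrier S \<subseteq> carrier skew_ring"
    by (auto simp: Psi_carrier)
  have "f \<in> Psi ` carrier S" if "f \<in> skew_carrier" for f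
    using that
  proof (induction f rule: skew_carrier_induct)
    case zero
    have "Psi \<zero>\<^bsub>S\<^esub> = 0"
      by (simp add: Psi_def)
    then show ?case
      by (metis S.zero_closed imageI)
  next
    case (add f g)
    then obtain u v where "u \<in> carrier S" "v \<in> carrier S" "f = Psi u" "g = Psi v"
      by blast
    then have "f + g = Psi (u \<oplus>\<^bsub>S\<^esub> v)" "u \<oplus>\<^bsub>S\<^esub> v \<in> carrier S"
      by (simp_all add: Psi_add)
    then show ?case by blast
  next
    case (const c f)
    then show ?case
      using rep_in_Psi_image[of f "scalar c"] by simp
  next
    case (var_x f)
    then show ?case
      using rep_in_Psi_image[of f gen_x] by simp
  next
    case (group c f)
    then show ?case
      by (intro group_in_Psi_image)
  next
    case (power n)
    show ?case
    proof (induction n)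
      case 0
      then show ?case
        using Psi_one S.one_closed by (metis imageI monom_0 one_pCons)
    next
      case (Suc n)
      then show ?case
        using rep_in_Psi_image[of "monom 1 n" gen_y] by (simp add: ymult_monom)
    qed
  qed
  then show "carrier skew_ring \<subseteq> Psi ` carrier S"
    by auto
qed

end

section \<open>The kernel as the ideal of the relator\<close>

context unipotent_smash
begin

text \<open>
  The inverse of \<open>Psi\<close> modulo the relator: \<open>q(x) g^c y^j\<close> is written in the smash product as
  \<open>q(x) (y + c x)^j g^c\<close>.
\<close>

definition sec :: "'k skew \<Rightarrow> 'k^2^2 \<Rightarrow> (2, 'k) free_algebra" where
  "sec f = (\<lambda>h. if h \<in> carrier G
     then poly_lin (\<lambda>j a. xpoly (Poly_Mapping.lookup a (h $ 1 $ 2)) * (gen_y + scalar (h $ 1 $ 2) * gen_x) ^ j) f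
     else 0)"

lemma sec_carrier: "sec f \<in> carrier S"
  by (simp add: sec_def)

lemma sec_unipotent: "c \<in> P \<Longrightarrow> sec f (unipotent c) =
    poly_lin (\<lambda>j a. xpoly (Poly_Mapping.lookup a c) * (gen_y + scalar c * gen_x) ^ j) f"
  by (simp add: sec_def)

lemma sec_add: "sec (f + g) = (\<lambda>h. sec f h + sec g h)"
  unfolding sec_def by (rule ext) (simp add: poly_lin_add lookup_add xpoly_add distrib_right)

lemma sec_0 [simp]: "sec 0 = (\<lambda>h. 0)"
  by (auto simp: sec_def poly_lin_def)

lemma sec_uminus: "sec (- f) = (\<lambda>h. - sec f h)"
proof -
  have "(\<lambda>h. sec f h + sec (- f) h) = (\<lambda>h. 0)"
    using sec_add[of f "- f"] by simp
  then show ?thesis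
    by (metis (no_types, lifting) add.inverse_unique)
qed

lemma sec_sum: "sec (sum F B) h = (\<Sum>b\<in>B. sec (F b) h)"
  by (induction B rule: infinite_finite_induct) (simp_all add: sec_add)

lemma sec_const: "c \<in> P \<Longrightarrow> sec (smult (const a) f) (unipotent c) = scalar a * sec f (unipotent c)"
  by (simp add: sec_unipotent poly_lin_smult mult_poly_lin const_def lookup_single_zero_mult
      xpoly_smult mult.assoc)

lemma sec_var_x: "c \<in> P \<Longrightarrow> sec (smult var_x f) (unipotent c) = gen_x * sec f (unipotent c)"
  by (simp add: sec_unipotent poly_lin_smult mult_poly_lin var_x_def lookup_single_zero_mult
      xpoly_var mult.assoc)

text \<open>\<open>sec\<close> respects group elements on the nose: \<open>g^d\<close> maps
  \<open>y + (c - d) x\<close> to \<open>y + c x\<close> and fixes polynomials in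
  \<open>x\<close>.\<close>

lemma sec_group:
  assumes c: "c \<in> P" and d: "d \<in> P"
  shows "sec (smult (grp d) f) (unipotent c) = linear_act (unipotent d) (sec f (unipotent (c - d)))"
proof -
  have "linear_act (unipotent d) (gen_y + scalar (c - d) * gen_x) = gen_y + scalar c * gen_x"
    by (simp add: linear_act_add linear_act_mult linear_act_unipotent_y add.assoc
        flip: distrib_right scalar_add)
  then show ?thesis
    using prime_field_diff[OF c d] c
    by (simp add: sec_unipotent poly_lin_smult lookup_single_one_mult)
       (simp add: poly_lin_def linear_act_sum linear_act_mult linear_act_power linear_act_xpoly)
qed

lemma sec_monom: "c \<in> P \<Longrightarrow> sec (monom 1 n) (unipotent c) = (if c = 0 then gen_y ^ n else 0)"
  by (simp add: sec_unipotent poly_lin_monom lookup_one when_def xpoly_1)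

lemma sec_1: "c \<in> P \<Longrightarrow> sec 1 (unipotent c) = (if c = 0 then 1 else 0)"
  using sec_monom[of c 0] by (simp add: monom_0 pCons_one)

lemma group_algebra_carrier: "smash_of_group_algebra lam \<in> carrier S"
  using lam by (simp add: smash_of_group_algebra_def group_algebra_elems_def)

text \<open>Multiplication by \<lambda> combines scalars and group elements, and \<open>sec\<close>
  respects both exactly.\<close>

lemma sec_L:
  assumes c: "c \<in> P"
  shows "sec (smult L f) (unipotent c) = (smash_of_group_algebra lam \<otimes>\<^bsub>S\<^esub> sec f) (unipotent c)"
proof -
  have "smult L f = (\<Sum>d\<in>P. smult (const (lam (unipotent d))) (smult (grp d) f))"
    by (simp add: L_def const_def smult_sum mult_single)
  then have "sec (smult L f) (unipotent c)
      = (\<Sum>d\<in>P. scalar (lam (unipotent d)) * linear_act (unipotent d) (sec f (unipotent (c - d))))"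
    using c by (simp only: sec_sum) (simp add: sec_const sec_group del: smult_smult)
  then show ?thesis
    by (simp add: S_mult c smash_of_group_algebra_def)
qed

abbreviation I :: "('k^2^2 \<Rightarrow> (2, 'k) free_algebra) set" where
  "I \<equiv> Idl\<^bsub>S\<^esub> {H_relator lam}"

lemma relator_carrier: "H_relator lam \<in> carrier S"
  unfolding H_relator_def by (rule S.minus_closed[OF emb_carrier group_algebra_carrier])

sublocale I: ideal I S
  by (rule S.genideal_ideal) (use relator_carrier in blast)

lemma relator_in_I: "H_relator lam \<in> I"
  by (rule S.genideal_self') (rule relator_carrier)

lemma relator_mult:
  assumes c: "c \<in> P" and v: "v \<in> carrier S"
  shows "(H_relator lam \<otimes>\<^bsub>S\<^esub> v) (unipotent c)
    = (gen_x * gen_y - gen_y * gen_x) * v (unipotent c) - (smash_of_group_algebra lam \<otimes>\<^bsub>S\<^esub> v) (unipotent c)"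
proof -
  let ?e = "emb (gen_x * gen_y - gen_y * gen_x)" and ?l = "smash_of_group_algebra lam"
  have "H_relator lam \<otimes>\<^bsub>S\<^esub> v = ?e \<otimes>\<^bsub>S\<^esub> v \<ominus>\<^bsub>S\<^esub> ?l \<otimes>\<^bsub>S\<^esub> v"
    unfolding H_relator_def a_minus_def
    using S.l_distr[OF emb_carrier S.a_inv_closed[OF group_algebra_carrier] v]
      S.l_minus[OF group_algebra_carrier v] by simp
  also have "\<dots> = (\<lambda>h. (?e \<otimes>\<^bsub>S\<^esub> v) h - (?l \<otimes>\<^bsub>S\<^esub> v) h)"
    by (rule S_minus) (rule S.m_closed[OF emb_carrier v] S.m_closed[OF group_algebra_carrier v])+
  finally show ?thesis
    by (simp add: emb_mult c)
qed

definition cong :: "('k^2^2 \<Rightarrow> (2, 'k) free_algebra) \<Rightarrow> ('k^2^2 \<Rightarrow> (2, 'k) free_algebra) \<Rightarrow> bool" where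
  "cong u v \<longleftrightarrow> u \<in> carrier S \<and> v \<in> carrier S \<and> u \<ominus>\<^bsub>S\<^esub> v \<in> I"

lemma cong_refl: "u \<in> carrier S \<Longrightarrow> cong u u"
  unfolding cong_def using I.zero_closed by (simp add: S.r_neg a_minus_def del: S_simps)

lemma cong_trans:
  assumes "cong u v" "cong v w" shows "cong u w"
proof -
  have c: "u \<in> carrier S" "v \<in> carrier S" "w \<in> carrier S"
    using assms by (simp_all add: cong_def del: S_simps)
  then have "u \<ominus>\<^bsub>S\<^esub> w = (u \<ominus>\<^bsub>S\<^esub> v) \<oplus>\<^bsub>S\<^esub> (v \<ominus>\<^bsub>S\<^esub> w)"
    by (simp only: S_minus) simp
  moreover have "(u \<ominus>\<^bsub>S\<^esub> v) \<oplus>\<^bsub>S\<^esub> (v \<ominus>\<^bsub>S\<^esub> w) \<in> I"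
    using assms by (intro I.a_closed) (simp_all add: cong_def)
  ultimately show ?thesis
    using c by (simp add: cong_def del: S_simps)
qed

lemma cong_add:
  assumes "cong u v" "cong u' v'"
  shows "cong (\<lambda>h. u h + u' h) (\<lambda>h. v h + v' h)"
proof -
  have c: "u \<in> carrier S" "v \<in> carrier S" "u' \<in> carrier S" "v' \<in> carrier S"
    using assms by (simp_all add: cong_def del: S_simps)
  then have c': "(\<lambda>h. u h + u' h) \<in> carrier S" "(\<lambda>h. v h + v' h) \<in> carrier S"
    by simp_all
  then have "(\<lambda>h. u h + u' h) \<ominus>\<^bsub>S\<^esub> (\<lambda>h. v h + v' h) = (u \<ominus>\<^bsub>S\<^esub> v) \<oplus>\<^bsub>S\<^esub> (u' \<ominus>\<^bsub>S\<^esub> v')"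
    using c by (simp only: S_minus) (simp add: fun_eq_iff)
  moreover have "(u \<ominus>\<^bsub>S\<^esub> v) \<oplus>\<^bsub>S\<^esub> (u' \<ominus>\<^bsub>S\<^esub> v') \<in> I"
    using assms by (intro I.a_closed) (simp_all add: cong_def)
  ultimately show ?thesis
    using c' by (simp add: cong_def del: S_simps)
qed

lemma mult_minus_right:
  assumes "w \<in> carrier S" "u \<in> carrier S" "v \<in> carrier S"
  shows "w \<otimes>\<^bsub>S\<^esub> (u \<ominus>\<^bsub>S\<^esub> v) = w \<otimes>\<^bsub>S\<^esub> u \<ominus>\<^bsub>S\<^esub> w \<otimes>\<^bsub>S\<^esub> v"
  unfolding a_minus_def
  using S.r_distr[OF assms(2) S.a_inv_closed[OF assms(3)] assms(1)] S.r_minus[OF assms(1,3)] by simp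

lemma cong_mult:
  assumes w: "w \<in> carrier S" and uv: "cong u v"
  shows "cong (w \<otimes>\<^bsub>S\<^esub> u) (w \<otimes>\<^bsub>S\<^esub> v)"
proof -
  have c: "u \<in> carrier S" "v \<in> carrier S"
    using uv by (simp_all add: cong_def del: S_simps)
  have "w \<otimes>\<^bsub>S\<^esub> (u \<ominus>\<^bsub>S\<^esub> v) \<in> I"
    using I.I_l_closed w uv by (simp add: cong_def del: S_simps)
  then show ?thesis
    using S.m_closed[OF w] c by (simp add: cong_def mult_minus_right w del: S_simps)
qed

lemma sec_const_mult: "sec (smult (const c) f) = emb (scalar c) \<otimes>\<^bsub>S\<^esub> sec f"
  and sec_var_x_mult: "sec (smult var_x f) = emb gen_x \<otimes>\<^bsub>S\<^esub> sec f"
  by (rule S_ext[OF sec_carrier S.m_closed[OF emb_carrier sec_carrier]];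
      simp add: emb_mult sec_const sec_var_x)+

text \<open>Here the relator enters: \<open>sec\<close> respects scalars, \<open>x\<close> and group
  elements exactly, but \<open>y\<close> only modulo \<open>I\<close>. The induction moves
  \<open>y\<close> to the right past the leftmost factor until only powers of \<open>y\<close>
  remain, where equality is exact.\<close>

lemma cong_gen_y_sec:
  assumes "f \<in> skew_carrier"
  shows "cong (emb gen_y \<otimes>\<^bsub>S\<^esub> sec f) (sec (ymult f))"
  using assms
proof (induction f rule: skew_carrier_induct)
  case zero
  have "emb gen_y \<otimes>\<^bsub>S\<^esub> sec 0 = sec 0"
    by (rule S_ext[OF S.m_closed[OF emb_carrier sec_carrier] sec_carrier]) (simp add: emb_mult)
  then show ?case
    using cong_refl[OF sec_carrier, of 0] by simp
next
  case (add f g)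
  have "emb gen_y \<otimes>\<^bsub>S\<^esub> sec (f + g)
      = (\<lambda>h. (emb gen_y \<otimes>\<^bsub>S\<^esub> sec f) h + (emb gen_y \<otimes>\<^bsub>S\<^esub> sec g) h)"
    using S.r_distr[OF sec_carrier[of f] sec_carrier[of g] emb_carrier[of gen_y]] by (simp add: sec_add)
  then show ?case
    using cong_add[OF add.IH] by (simp add: ymult_add sec_add)
next
  case (const c f)
  have "emb gen_y \<otimes>\<^bsub>S\<^esub> sec (smult (const c) f) = emb (scalar c) \<otimes>\<^bsub>S\<^esub> (emb gen_y \<otimes>\<^bsub>S\<^esub> sec f)"
    by (rule S_ext[OF S.m_closed[OF emb_carrier sec_carrier]
          S.m_closed[OF emb_carrier S.m_closed[OF emb_carrier sec_carrier]]])
       (simp add: emb_mult sec_const scalar_commute[of c gen_y] flip: mult.assoc)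
  then show ?case
    using cong_mult[OF emb_carrier const.IH, of "scalar c"] by (simp add: ymult_const sec_const_mult)
next
  case (var_x f)
  let ?u = "emb gen_y \<otimes>\<^bsub>S\<^esub> sec f" and ?v = "sec (ymult f)"
  let ?d = "emb gen_y \<otimes>\<^bsub>S\<^esub> sec (smult var_x f) \<ominus>\<^bsub>S\<^esub> sec (ymult (smult var_x f))"
  have c: "?u \<in> carrier S" "H_relator lam \<otimes>\<^bsub>S\<^esub> sec f \<in> carrier S"
    "emb gen_x \<otimes>\<^bsub>S\<^esub> ?u \<in> carrier S" "emb gen_x \<otimes>\<^bsub>S\<^esub> ?v \<in> carrier S"
    "emb gen_y \<otimes>\<^bsub>S\<^esub> sec (smult var_x f) \<in> carrier S"
    by (intro S.m_closed emb_carrier sec_carrier relator_carrier)+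
  have I1: "H_relator lam \<otimes>\<^bsub>S\<^esub> sec f \<in> I"
    by (rule I.I_r_closed[OF relator_in_I sec_carrier])
  have I2: "emb gen_x \<otimes>\<^bsub>S\<^esub> ?u \<ominus>\<^bsub>S\<^esub> emb gen_x \<otimes>\<^bsub>S\<^esub> ?v \<in> I"
    using cong_mult[OF emb_carrier var_x.IH, of gen_x] by (simp add: cong_def)
  \<comment> \<open>Rewriting \<open>y x\<close> as \<open>x y\<close> minus the commutator: the
    relator replaces the commutator by \<lambda>, which matches the term \<open>- smult L f\<close>
    produced by \<open>der_var_x\<close>.\<close>
  have "?d = (emb gen_x \<otimes>\<^bsub>S\<^esub> ?u \<ominus>\<^bsub>S\<^esub> emb gen_x \<otimes>\<^bsub>S\<^esub> ?v) \<ominus>\<^bsub>S\<^esub> H_relator lam \<otimes>\<^bsub>S\<^esub> sec f"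
  proof (rule S_ext)
    show "?d \<in> carrier S" "(emb gen_x \<otimes>\<^bsub>S\<^esub> ?u \<ominus>\<^bsub>S\<^esub> emb gen_x \<otimes>\<^bsub>S\<^esub> ?v) \<ominus>\<^bsub>S\<^esub> H_relator lam \<otimes>\<^bsub>S\<^esub> sec f \<in> carrier S"
      by (intro S.minus_closed c sec_carrier)+
    fix a assume a: "a \<in> P"
    have "ymult (smult var_x f) = - smult L f + smult var_x (ymult f)"
      by (simp add: ymult_smult der_var_x)
    then have "sec (ymult (smult var_x f)) (unipotent a)
        = - (smash_of_group_algebra lam \<otimes>\<^bsub>S\<^esub> sec f) (unipotent a) + gen_x * ?v (unipotent a)"
      by (simp only: sec_add sec_uminus sec_L[OF a] sec_var_x[OF a])
    then have "?d (unipotent a)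
        = gen_y * (gen_x * sec f (unipotent a))
          - (- (smash_of_group_algebra lam \<otimes>\<^bsub>S\<^esub> sec f) (unipotent a) + gen_x * ?v (unipotent a))"
      by (simp only: S_minus[OF c(5) sec_carrier] emb_mult[OF a] sec_var_x[OF a])
    moreover have "(emb gen_x \<otimes>\<^bsub>S\<^esub> ?u \<ominus>\<^bsub>S\<^esub> emb gen_x \<otimes>\<^bsub>S\<^esub> ?v \<ominus>\<^bsub>S\<^esub> H_relator lam \<otimes>\<^bsub>S\<^esub> sec f) (unipotent a)
        = gen_x * (gen_y * sec f (unipotent a)) - gen_x * ?v (unipotent a)
          - ((gen_x * gen_y - gen_y * gen_x) * sec f (unipotent a)
             - (smash_of_group_algebra lam \<otimes>\<^bsub>S\<^esub> sec f) (unipotent a))"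
      by (subst S_minus[OF S.minus_closed[OF c(3,4)] c(2)], subst S_minus[OF c(3,4)])
         (simp only: relator_mult[OF a sec_carrier] emb_mult[OF a])
    ultimately show "?d (unipotent a) = (emb gen_x \<otimes>\<^bsub>S\<^esub> ?u \<ominus>\<^bsub>S\<^esub> emb gen_x \<otimes>\<^bsub>S\<^esub> ?v \<ominus>\<^bsub>S\<^esub> H_relator lam \<otimes>\<^bsub>S\<^esub> sec f) (unipotent a)"
      by (simp only:) (simp add: algebra_simps)
  qed
  also have "\<dots> \<in> I"
    unfolding a_minus_def[of S _ "H_relator lam \<otimes>\<^bsub>S\<^esub> sec f"]
    by (intro I.a_closed I.a_inv_closed I1 I2)
  finally show ?case
    using c sec_carrier by (simp add: cong_def del: S_simps)
next
  case (group d f)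
  let ?u = "emb gen_y \<otimes>\<^bsub>S\<^esub> sec f" and ?v = "sec (ymult f)" and ?g = "smash_of_group (unipotent d)"
  let ?d = "emb gen_y \<otimes>\<^bsub>S\<^esub> sec (smult (grp d) f) \<ominus>\<^bsub>S\<^esub> sec (ymult (smult (grp d) f))"
  have d: "d \<in> P"
    by (rule group)
  have c: "?u \<in> carrier S" "emb gen_y \<otimes>\<^bsub>S\<^esub> sec (smult (grp d) f) \<in> carrier S"
    "?g \<otimes>\<^bsub>S\<^esub> ?u \<in> carrier S" "?g \<otimes>\<^bsub>S\<^esub> ?v \<in> carrier S"
    by (intro S.m_closed emb_carrier sec_carrier smash_of_group_carrier d)+
  \<comment> \<open>Since \<open>g^d y = (y + d x) g^d\<close>, the correction \<open>d x\<close>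
    cancels the derivative of \<open>g^d\<close>. No further relator term appears.\<close>
  have "?d = ?g \<otimes>\<^bsub>S\<^esub> ?u \<ominus>\<^bsub>S\<^esub> ?g \<otimes>\<^bsub>S\<^esub> ?v"
  proof (rule S_ext)
    show "?d \<in> carrier S" "?g \<otimes>\<^bsub>S\<^esub> ?u \<ominus>\<^bsub>S\<^esub> ?g \<otimes>\<^bsub>S\<^esub> ?v \<in> carrier S"
      by (intro S.minus_closed c sec_carrier)+
    fix a assume a: "a \<in> P"
    have "ymult (smult (grp d) f)
        = - smult (const d) (smult var_x (smult (grp d) f)) + smult (grp d) (ymult f)"
      by (simp add: ymult_smult der_group mult.assoc)
    then have "sec (ymult (smult (grp d) f)) (unipotent a)
        = - (scalar d * (gen_x * linear_act (unipotent d) (sec f (unipotent (a - d)))))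
          + linear_act (unipotent d) (?v (unipotent (a - d)))"
      by (simp only: sec_add sec_uminus sec_const[OF a] sec_var_x[OF a] sec_group[OF a d])
    then have "?d (unipotent a)
        = gen_y * linear_act (unipotent d) (sec f (unipotent (a - d)))
          - (- (scalar d * (gen_x * linear_act (unipotent d) (sec f (unipotent (a - d)))))
             + linear_act (unipotent d) (?v (unipotent (a - d))))"
      by (simp only: S_minus[OF c(2) sec_carrier] emb_mult[OF a] sec_group[OF a d])
    moreover have "(?g \<otimes>\<^bsub>S\<^esub> ?u \<ominus>\<^bsub>S\<^esub> ?g \<otimes>\<^bsub>S\<^esub> ?v) (unipotent a)
        = (gen_y + scalar d * gen_x) * linear_act (unipotent d) (sec f (unipotent (a - d)))
          - linear_act (unipotent d) (?v (unipotent (a - d)))"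
      by (simp only: S_minus[OF c(3,4)] smash_of_group_mult[OF a d] emb_mult[OF prime_field_diff[OF a d]]
          linear_act_mult linear_act_unipotent_y)
    ultimately show "?d (unipotent a) = (?g \<otimes>\<^bsub>S\<^esub> ?u \<ominus>\<^bsub>S\<^esub> ?g \<otimes>\<^bsub>S\<^esub> ?v) (unipotent a)"
      by (simp only:) (simp add: algebra_simps)
  qed
  then show ?case
    using cong_mult[OF smash_of_group_carrier[OF d] group.IH] c sec_carrier
    by (simp add: cong_def del: S_simps)
next
  case (power n)
  have "emb gen_y \<otimes>\<^bsub>S\<^esub> sec (monom 1 n) = sec (ymult (monom 1 n))"
    by (rule S_ext[OF S.m_closed[OF emb_carrier sec_carrier] sec_carrier])
       (simp add: emb_mult sec_monom ymult_monom)
  then show ?case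
    using cong_refl[OF sec_carrier] by simp
qed

text \<open>Prepending a letter preserves the congruence: for \<open>x\<close> because
  \<open>sec\<close> respects it exactly, for \<open>y\<close> by
  \<open>cong_gen_y_sec\<close>.\<close>

lemma cong_sec_Psi_emb_mult:
  assumes u: "cong u (sec (Psi u))"
  shows "cong (emb a \<otimes>\<^bsub>S\<^esub> u) (sec (Psi (emb a \<otimes>\<^bsub>S\<^esub> u)))"
proof (induction a rule: free_algebra_induct_gen)
  case (scalar c)
  show ?case
    using cong_mult[OF emb_carrier u, of "scalar c"] by (simp add: Psi_emb_mult sec_const_mult)
next
  case (gen i a)
  let ?v = "emb a \<otimes>\<^bsub>S\<^esub> u"
  have uc: "u \<in> carrier S"
    using u by (simp add: cong_def)
  have eq: "emb (gen i * a) \<otimes>\<^bsub>S\<^esub> u = emb (gen i) \<otimes>\<^bsub>S\<^esub> ?v"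
    by (rule S_ext[OF S.m_closed[OF emb_carrier uc]
          S.m_closed[OF emb_carrier S.m_closed[OF emb_carrier uc]]])
       (simp add: emb_mult mult.assoc)
  have step: "cong (emb (gen i) \<otimes>\<^bsub>S\<^esub> ?v) (emb (gen i) \<otimes>\<^bsub>S\<^esub> sec (Psi ?v))"
    by (rule cong_mult[OF emb_carrier gen.IH])
  show ?case
  proof (cases "i = 1")
    case True
    then show ?thesis
      using step unfolding eq by (simp add: Psi_emb_mult sec_var_x_mult)
  next
    case False
    then have "i = 2"
      using exhaust_2 by blast
    then show ?thesis
      using cong_trans[OF step] cong_gen_y_sec[OF Psi_carrier, of ?v] unfolding eq
      by (simp add: Psi_emb_mult)
  qed
next
  case (add a b)
  have uc: "u \<in> carrier S"
    using u by (simp add: cong_def)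
  have "emb (a + b) \<otimes>\<^bsub>S\<^esub> u = emb a \<otimes>\<^bsub>S\<^esub> u \<oplus>\<^bsub>S\<^esub> emb b \<otimes>\<^bsub>S\<^esub> u"
    by (rule S_ext[OF S.m_closed[OF emb_carrier uc]
          S.a_closed[OF S.m_closed[OF emb_carrier uc] S.m_closed[OF emb_carrier uc]]])
       (simp add: emb_mult distrib_right)
  then show ?case
    using cong_add[OF add.IH] by (simp add: Psi_add sec_add)
qed

text \<open>Group elements are fixed by \<open>sec\<close> after \<open>Psi\<close>, and
  \<open>u\<close> is a finite sum of algebra elements times group elements. The induction adds one
  group element of the support at a time.\<close>

lemma cong_sec_Psi:
  assumes u: "u \<in> carrier S"
  shows "cong u (sec (Psi u))"
proof -
  have Psi0: "Psi (\<lambda>h. 0) = 0"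
    by (simp add: Psi_def)
  have "cong (\<lambda>h. if h \<in> unipotent ` B then u h else 0)
      (sec (Psi (\<lambda>h. if h \<in> unipotent ` B then u h else 0)))" if "finite B" "B \<subseteq> P" for B
    using that
  proof (induction B)
    case empty
    then show ?case
      using cong_refl[OF sec_carrier, of 0] by (simp add: Psi0)
  next
    case (insert c B)
    let ?g = "smash_of_group (unipotent c)"
    have c: "c \<in> P"
      using insert by simp
    have g: "sec (Psi ?g) = ?g"
    proof (rule S_ext[OF sec_carrier smash_of_group_carrier[OF c]])
      fix d assume d: "d \<in> P"
      show "sec (Psi ?g) (unipotent d) = ?g (unipotent d)"
        using sec_group[OF d c, of 1] prime_field_diff[OF d c]
        unfolding Psi_smash_of_group[OF c] by (simp add: sec_1 smash_of_group_def)
    qed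
    have "cong ?g (sec (Psi ?g))"
      unfolding g by (rule cong_refl[OF smash_of_group_carrier[OF c]])
    then have "cong (emb (u (unipotent c)) \<otimes>\<^bsub>S\<^esub> ?g) (sec (Psi (emb (u (unipotent c)) \<otimes>\<^bsub>S\<^esub> ?g)))"
      by (rule cong_sec_Psi_emb_mult)
    moreover have "(\<lambda>h. if h \<in> unipotent ` insert c B then u h else 0)
        = (emb (u (unipotent c)) \<otimes>\<^bsub>S\<^esub> ?g) \<oplus>\<^bsub>S\<^esub> (\<lambda>h. if h \<in> unipotent ` B then u h else 0)"
    proof (rule S_ext)
      show "(emb (u (unipotent c)) \<otimes>\<^bsub>S\<^esub> ?g) \<oplus>\<^bsub>S\<^esub> (\<lambda>h. if h \<in> unipotent ` B then u h else 0) \<in> carrier S"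
        by (intro S.a_closed S.m_closed emb_carrier smash_of_group_carrier c) (use u in auto)
    qed (use u insert in \<open>auto simp: emb_mult smash_of_group_def image_iff\<close>)
    ultimately show ?case
      using cong_add insert by (simp add: Psi_add sec_add)
  qed
  from this[OF finite_prime_field order_refl]
  have "cong (\<lambda>h. if h \<in> unipotent ` P then u h else 0)
      (sec (Psi (\<lambda>h. if h \<in> unipotent ` P then u h else 0)))" .
  moreover have "(\<lambda>h. if h \<in> unipotent ` P then u h else 0) = u"
    using u by (auto simp: carrier_G)
  ultimately show ?thesis
    by simp
qed

text \<open>Acting on \<open>1\<close>, the commutator of \<open>x\<close> and \<open>y\<close>
  gives \<open>- \<delta>(x)\<close>, which is \<lambda>.\<close>

lemma Psi_relator: "Psi (H_relator lam) = 0"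
proof -
  have "H_relator lam = (\<lambda>h. emb (gen_x * gen_y - gen_y * gen_x) h - smash_of_group_algebra lam h)"
    unfolding H_relator_def by (rule S_minus[OF emb_carrier group_algebra_carrier])
  then have "Psi (H_relator lam) + Psi (smash_of_group_algebra lam) = Psi (emb (gen_x * gen_y - gen_y * gen_x))"
    by (simp flip: Psi_add)
  moreover have "Psi (smash_of_group_algebra lam) = [:L:]"
  proof -
    have "Psi (smash_of_group_algebra lam)
        = (\<Sum>c\<in>P. smult (Poly_Mapping.single c [:lam (unipotent c):]) 1)"
      by (simp add: Psi_def smash_of_group_algebra_def const_def mult_single)
    also have "\<dots> = smult L 1"
      by (simp only: L_def smult_sum)
    finally show ?thesis
      by simp
  qed
  moreover have "Psi (emb (gen_x * gen_y - gen_y * gen_x)) = [:L:]"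
  proof -
    have "rep (gen_x * gen_y - gen_y * gen_x) 1 + rep (gen_y * gen_x) 1 = rep (gen_x * gen_y) 1"
      by (simp flip: rep_add)
    also have "\<dots> = smult L 1 + rep (gen_y * gen_x) 1"
      by (simp only: rep_mult rep_x rep_y ymult_smult der_var_x) (simp flip: smult_add_left)
    finally show ?thesis
      by (simp add: Psi_emb)
  qed
  ultimately show ?thesis
    by simp
qed

text \<open>If \<open>Psi u = 0\<close>, then \<open>u\<close> is congruent to
  \<open>sec 0 = 0\<close>, hence lies in \<open>I\<close>. The converse is
  \<open>Psi_relator\<close> with minimality of the generated ideal.\<close>

lemma kernel_Psi: "a_kernel S skew_ring Psi = I"
proof
  interpret h: ring_hom_ring S skew_ring Psi
    by (rule Psi_ring_hom)
  show "I \<subseteq> a_kernel S skew_ring Psi"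
  proof (rule S.genideal_minimal[OF h.kernel_is_ideal])
    have "H_relator lam \<in> a_kernel S skew_ring Psi"
      unfolding a_kernel_def' by (intro CollectI conjI relator_carrier) (simp add: Psi_relator)
    then show "{H_relator lam} \<subseteq> a_kernel S skew_ring Psi"
      by blast
  qed
  show "a_kernel S skew_ring Psi \<subseteq> I"
  proof
    fix u assume "u \<in> a_kernel S skew_ring Psi"
    then have u: "u \<in> carrier S" "Psi u = 0"
      unfolding a_kernel_def' by (simp_all only: mem_Collect_eq skew_ring_simps)
    have "u \<ominus>\<^bsub>S\<^esub> (\<lambda>h. 0) \<in> I"
      using cong_sec_Psi[OF u(1)] by (simp only: cong_def u(2) sec_0)
    moreover have "u \<ominus>\<^bsub>S\<^esub> (\<lambda>h. 0) = u"
      using S_minus[OF u(1), of "\<lambda>h. 0"] by simp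
    ultimately show "u \<in> I" by simp
  qed
qed

lemma H_algebra_iso: "(\<lambda>X. the_elem (Psi ` X)) \<in> ring_iso (H_algebra lam) skew_ring"
  using ring_hom_ring.FactRing_iso_set[OF Psi_ring_hom Psi_surj]
  by (simp add: H_algebra_def kernel_Psi)

lemma H_algebra_ring: "ring (H_algebra lam)"
  unfolding H_algebra_def by (rule I.quotient_is_ring)

theorem jacobson_radical_H_algebra:
  assumes "infinite (UNIV :: 'k set)" "prime (CHAR('k))"
  shows "jacobson_radical (H_algebra lam) = {\<zero>\<^bsub>H_algebra lam\<^esub>}"
proof -
  let ?\<phi> = "\<lambda>X. the_elem (Psi ` X)"
  interpret H: ring "H_algebra lam"
    by (rule H_algebra_ring)
  have inj: "inj_on ?\<phi> (carrier (H_algebra lam))"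
    using ring_iso_memE(5)[OF H_algebra_iso] by (simp add: bij_betw_def)
  have zero: "?\<phi> \<zero>\<^bsub>H_algebra lam\<^esub> = 0"
    using ring_hom_zero[OF _ H_algebra_ring skew_ring_ring] H_algebra_iso by (fastforce simp: ring_iso_def)
  have "X = \<zero>\<^bsub>H_algebra lam\<^esub>" if X: "X \<in> jacobson_radical (H_algebra lam)" for X
  proof -
    have "?\<phi> X \<in> jacobson_radical skew_ring"
      by (rule jacobson_radical_ring_iso[OF H_algebra_ring skew_ring_ring H_algebra_iso X])
    then have "?\<phi> X = ?\<phi> \<zero>\<^bsub>H_algebra lam\<^esub>"
      using jacobson_radical_skew_ring[OF assms] zero by simp
    then show ?thesis
      using inj X H.jacobson_radical_subset by (auto dest: inj_onD)
  qed
  moreover have "\<zero>\<^bsub>H_algebra lam\<^esub> \<in> jacobson_radical (H_algebra lam)"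
    by (rule H.left_ideal_zero[OF H.jacobson_radical_left_ideal])
  ultimately show ?thesis
    by blast
qed

end

theorem proposition5p16:
  fixes p :: nat and lam :: "'k::alg_closed_field^2^2 \<Rightarrow> 'k"
  assumes "prime p" and "odd p" and "CHAR('k) = p"
    and "lam \<in> group_algebra_elems transvection_group"
  shows "jacobson_radical (H_algebra lam) = {\<zero>\<^bsub>H_algebra lam\<^esub>}"
proof -
  have "CHAR('k) > 0"
    using assms(1,3) by (simp add: prime_gt_0_nat)
  then interpret unipotent_smash lam
    using assms(4) by (rule unipotent_smash.intro)
  have "prime (CHAR('k))"
    using assms(1,3) by simp
  then show ?thesis
    by (rule jacobson_radical_H_algebra[OF infinite_UNIV_alg_closed])
qed

end
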